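(* Let $h$ be an element of the comeager conjugacy class of $\mathcal H(\{0,1\}^{\mathbb N})$. Then $h$ is chain continuous at every nonrecurrent point, and so it is chain continuous at every point of a dense open subset of $\{0,1\}^{\mathbb N}$; but there is an uncountable subset of $\{0,1\}^{\mathbb N}$ such that $h$ is not equicontinuous at each point of this set.
   Context: $\{0,1\}^{\mathbb N}$ ($\mathbb N$ the positive integers) has the product topology and the metric $d(\sigma,\tau)=1/n$, where $n$ is the least positive integer with $\sigma(n)\neq\tau(n)$, and $d(\sigma,\sigma)=0$. $\mathcal H(\{0,1\}^{\mathbb N})$ is the group of all homeomorphisms of $\{0,1\}^{\mathbb N}$ onto itself, with the topology given by the metric $\tilde d(f,g)=\max_\sigma d(f(\sigma),g(\sigma))$. This group has a conjugacy class that is a comeager subset (necessarily unique), called the comeager conjugacy class of $\mathcal H(\{0,1\}^{\mathbb N})$. Let $f$ be a self-map of a metric space $X$ and $x\in X$. The point $x$ is recurrent if $x$ is the limit of a subsequence of $(f^n(x))_{n\in\mathbb N}$, and nonrecurrent otherwise. The map $f$ is equicontinuous at $x$ if for every $\epsilon>0$ there is $\delta>0$ such that $d(y,x)<\delta$ implies $d(f^n(y),f^n(x))<\epsilon$ for every $n\ge0$. The map $f$ is chain continuous at $x$ if for every $\epsilon>0$ there is $\delta>0$ such that for any choice of points $x_0\in B(x;\delta)$, $x_1\in B(f(x_0);\delta)$, $x_2\in B(f(x_1);\delta),\dots$ one has $d(x_n,f^n(x))<\epsilon$ for every $n\ge0$. Here $B(y;\delta)$ is the open ball of center $y$ and radius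 $\delta$. *)

theory Defs
  imports "HOL-Analysis.Analysis" "HOL-Algebra.Group"
begin

section \<open>Dynamics of a self-map of a metric space\<close>

context Metric_space
begin

text \<open>The sequence of iterates starts with \<open>f x\<close>, not with \<open>x\<close>; its subsequences
  are the compositions with strictly increasing maps.\<close>

definition recurrent :: "('a \<Rightarrow> 'a) \<Rightarrow> 'a \<Rightarrow> bool" where
  "recurrent f x \<longleftrightarrow>
     (\<exists>r :: nat \<Rightarrow> nat. strict_mono r \<and>
        limitin mtopology ((\<lambda>n. (f ^^ Suc n) x) \<circ> r) x sequentially)"

definition equicontinuous_at :: "('a \<Rightarrow> 'a) \<Rightarrow> 'a \<Rightarrow> bool" where
  "equicontinuous_at f x \<longleftrightarrow>
     (\<forall>\<epsilon>>0. \<exists>\<delta>>0. \<forall>y\<in>M. d y x < \<delta> \<longrightarrow> (\<forall>n. d ((f ^^ n) y) ((f ^^ n) x) < \<epsilon>))"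

definition chain_continuous_at :: "('a \<Rightarrow> 'a) \<Rightarrow> 'a \<Rightarrow> bool" where
  "chain_continuous_at f x \<longleftrightarrow>
     (\<forall>\<epsilon>>0. \<exists>\<delta>>0. \<forall>y :: nat \<Rightarrow> 'a.
        y 0 \<in> mball x \<delta> \<and> (\<forall>n. y (Suc n) \<in> mball (f (y n)) \<delta>) \<longrightarrow>
        (\<forall>n. d (y n) ((f ^^ n) x) < \<epsilon>))"

end


section \<open>Meager and comeager sets, conjugacy classes\<close>

definition nowhere_dense_in :: "'a topology \<Rightarrow> 'a set \<Rightarrow> bool" where
  "nowhere_dense_in X S \<longleftrightarrow> S \<subseteq> topspace X \<and> X interior_of (X closure_of S) = {}"

definition meager_in :: "'a topology \<Rightarrow> 'a set \<Rightarrow> bool" where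
  "meager_in X S \<longleftrightarrow>
     (\<exists>\<N>. countable \<N> \<and> (\<forall>N\<in>\<N>. nowhere_dense_in X N) \<and> S = \<Union>\<N>)"

definition comeager_in :: "'a topology \<Rightarrow> 'a set \<Rightarrow> bool" where
  "comeager_in X S \<longleftrightarrow> S \<subseteq> topspace X \<and> meager_in X (topspace X - S)"

definition conjugacy_class :: "('a, 'b) monoid_scheme \<Rightarrow> 'a \<Rightarrow> 'a set" where
  "conjugacy_class G a = {g \<otimes>\<^bsub>G\<^esub> a \<otimes>\<^bsub>G\<^esub> inv\<^bsub>G\<^esub> g | g. g \<in> carrier G}"


section \<open>The Cantor space and its homeomorphism group\<close>

text \<open>Coordinates are numbered from 0, so that coordinate \<open>n\<close> here is coordinate
  \<open>n + 1\<close> for the index set of positive integers. The topological notions \<open>open\<close>,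
  \<open>closure\<close>, \<open>homeomorphism\<close> refer to the product topology that the library puts on
  function types.\<close>

type_synonym cantor = "nat \<Rightarrow> bool"

definition cantor_dist :: "cantor \<Rightarrow> cantor \<Rightarrow> real" where
  "cantor_dist \<sigma> \<tau> =
     (if \<sigma> = \<tau> then 0 else 1 / real (Suc (LEAST n. \<sigma> n \<noteq> \<tau> n)))"

lemma cantor_dist_nonneg: "0 \<le> cantor_dist \<sigma> \<tau>"
  by (simp add: cantor_dist_def)

lemma cantor_dist_le_1: "cantor_dist \<sigma> \<tau> \<le> 1"
  by (simp add: cantor_dist_def)

lemma cantor_dist_less_iff:
  "cantor_dist \<sigma> \<tau> < 1 / real (Suc k) \<longleftrightarrow> (\<forall>i\<le>k. \<sigma> i = \<tau> i)"
proof (cases "\<sigma> = \<tau>")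
  case False
  then have ex: "\<exists>n. \<sigma> n \<noteq> \<tau> n" by auto
  define m where "m = (LEAST n. \<sigma> n \<noteq> \<tau> n)"
  have m: "\<sigma> m \<noteq> \<tau> m" "\<And>i. i < m \<Longrightarrow> \<sigma> i = \<tau> i"
    unfolding m_def using LeastI_ex[OF ex] not_less_Least by blast+
  have "cantor_dist \<sigma> \<tau> < 1 / real (Suc k) \<longleftrightarrow> k < m"
    using False unfolding cantor_dist_def m_def[symmetric] by (simp add: field_simps)
  also have "\<dots> \<longleftrightarrow> (\<forall>i\<le>k. \<sigma> i = \<tau> i)"
    using m by (meson le_less_trans not_less)
  finally show ?thesis .
qed (simp add: cantor_dist_def)

lemma cantor_dist_commute: "cantor_dist \<sigma> \<tau> = cantor_dist \<tau> \<sigma>"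
proof -
  have "(\<lambda>n. \<sigma> n \<noteq> \<tau> n) = (\<lambda>n. \<tau> n \<noteq> \<sigma> n)" by auto
  then show ?thesis unfolding cantor_dist_def by auto
qed

lemma cantor_dist_ultra: "cantor_dist \<sigma> \<upsilon> \<le> max (cantor_dist \<sigma> \<tau>) (cantor_dist \<tau> \<upsilon>)"
proof (cases "\<sigma> = \<upsilon>")
  case True
  then show ?thesis using cantor_dist_nonneg[of \<sigma> \<tau>] by (simp add: cantor_dist_def)
next
  case False
  define k where "k = (LEAST n. \<sigma> n \<noteq> \<upsilon> n)"
  have d: "cantor_dist \<sigma> \<upsilon> = 1 / real (Suc k)"
    using False by (simp add: cantor_dist_def k_def)
  show ?thesis
  proof (rule ccontr)
    assume "\<not> ?thesis"
    then have "cantor_dist \<sigma> \<tau> < 1 / real (Suc k)" "cantor_dist \<tau> \<upsilon> < 1 / real (Suc k)"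
      using d by auto
    then have "cantor_dist \<sigma> \<upsilon> < 1 / real (Suc k)"
      unfolding cantor_dist_less_iff by auto
    then show False using d by simp
  qed
qed

interpretation Cantor: Metric_space "UNIV :: cantor set" cantor_dist
proof
  fix \<sigma> \<tau> \<upsilon> :: cantor
  show "0 \<le> cantor_dist \<sigma> \<tau>" by (rule cantor_dist_nonneg)
  show "cantor_dist \<sigma> \<tau> = cantor_dist \<tau> \<sigma>" by (rule cantor_dist_commute)
  show "cantor_dist \<sigma> \<tau> = 0 \<longleftrightarrow> \<sigma> = \<tau>" by (simp add: cantor_dist_def)
  show "cantor_dist \<sigma> \<upsilon> \<le> cantor_dist \<sigma> \<tau> + cantor_dist \<tau> \<upsilon>"
    using cantor_dist_ultra[of \<sigma> \<upsilon> \<tau>] cantor_dist_nonneg[of \<sigma> \<tau>]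
      cantor_dist_nonneg[of \<tau> \<upsilon>] by linarith
qed

lemma Cantor_mtopology: "Cantor.mtopology = euclidean"
proof (rule topology_eq[THEN iffD2], intro allI iffI)
  fix U :: "cantor set"
  assume "openin Cantor.mtopology U"
  show "openin euclidean U"
    unfolding open_openin[symmetric]
  proof (subst open_subopen, intro ballI)
    fix x assume "x \<in> U"
    then obtain r where r: "r > 0" "Cantor.mball x r \<subseteq> U"
      using \<open>openin Cantor.mtopology U\<close> unfolding Cantor.openin_mtopology by blast
    obtain k where k: "1 / real (Suc k) < r"
      using r(1) by (metis nat_approx_posE)
    define V where "V = PiE UNIV (\<lambda>i. if i \<le> k then {x i} else UNIV)"
    have "open V"
      unfolding V_def by (rule open_PiE) (auto intro: open_discrete)
    moreover have "x \<in> V" by (auto simp: V_def PiE_def)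
    moreover have "V \<subseteq> U"
    proof
      fix y assume "y \<in> V"
      then have yi: "y i \<in> (if i \<le> k then {x i} else UNIV)" for i
        unfolding V_def by (rule PiE_mem) simp
      have "x i = y i" if "i \<le> k" for i
        using yi[of i] that by simp
      then have "\<forall>i\<le>k. x i = y i" by blast
      then have "cantor_dist x y < 1 / real (Suc k)" by (simp only: cantor_dist_less_iff)
      with k r(2) show "y \<in> U" by (auto simp: subset_iff)
    qed
    ultimately show "\<exists>T. open T \<and> x \<in> T \<and> T \<subseteq> U" by blast
  qed
next
  fix U :: "cantor set"
  assume "openin euclidean U"
  then have op: "open U" by (simp only: open_openin)
  show "openin Cantor.mtopology U"
    unfolding Cantor.openin_mtopology
  proof (intro conjI allI impI)
    fix x assume "x \<in> U"
    then obtain X where X: "x \<in> PiE UNIV X" "finite {i. X i \<noteq> UNIV}" "PiE UNIV X \<subseteq> U"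
      using op product_topology_open_contains_basis[of "\<lambda>i. euclidean" UNIV U x]
      unfolding open_fun_def topspace_euclidean by blast
    obtain k where k: "\<And>i. X i \<noteq> UNIV \<Longrightarrow> i \<le> k"
      using X(2) finite_nat_set_iff_bounded_le by auto
    have "Cantor.mball x (1 / real (Suc k)) \<subseteq> U"
    proof
      fix y assume "y \<in> Cantor.mball x (1 / real (Suc k))"
      then have eq: "\<forall>i\<le>k. x i = y i" 
        unfolding Cantor.in_mball cantor_dist_less_iff by blast
      have "y i \<in> X i" for i
      proof (cases "i \<le> k")
        case True
        then show ?thesis using PiE_mem[OF X(1), of i] eq by simp
      next
        case False
        then show ?thesis using k[of i] by blast
      qed
      then show "y \<in> U" using X(3) by (auto simp: PiE_UNIV_domain)
    qed
    then show "\<exists>r>0. Cantor.mball x r \<subseteq> U" by (intro exI[of _ "1 / real (Suc k)"]) simp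
  qed simp
qed

definition cantor_homeo :: "(cantor \<Rightarrow> cantor) monoid" where
  "cantor_homeo =
     \<lparr>carrier = {f. \<exists>g. homeomorphism UNIV UNIV f g}, mult = (\<circ>), one = id\<rparr>"

lemma group_cantor_homeo: "group cantor_homeo"
proof (rule groupI)
  fix f g assume "f \<in> carrier cantor_homeo" "g \<in> carrier cantor_homeo"
  then show "f \<otimes>\<^bsub>cantor_homeo\<^esub> g \<in> carrier cantor_homeo"
    by (auto simp: cantor_homeo_def intro: homeomorphism_compose)
next
  show "\<one>\<^bsub>cantor_homeo\<^esub> \<in> carrier cantor_homeo"
    by (auto simp: cantor_homeo_def homeomorphism_def intro!: exI[of _ id])
next
  fix f assume "f \<in> carrier cantor_homeo"
  then obtain g where g: "homeomorphism UNIV UNIV f g" by (auto simp: cantor_homeo_def)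
  then have "homeomorphism UNIV UNIV g f" "g \<circ> f = id"
    by (auto simp: homeomorphism_def)
  then show "\<exists>g\<in>carrier cantor_homeo. g \<otimes>\<^bsub>cantor_homeo\<^esub> f = \<one>\<^bsub>cantor_homeo\<^esub>"
    by (auto simp: cantor_homeo_def)
qed (auto simp: cantor_homeo_def)

lemma inv_cantor_homeo:
  assumes "f \<in> carrier cantor_homeo"
  shows "inv\<^bsub>cantor_homeo\<^esub> f = inv_into UNIV f"
proof -
  obtain g where g: "homeomorphism UNIV UNIV f g"
    using assms by (auto simp: cantor_homeo_def)
  then have gf: "\<And>x. g (f x) = x" "\<And>y. f (g y) = y" by (auto simp: homeomorphism_def)
  have "inv_into UNIV f = g" by (rule inv_unique_comp) (simp_all add: fun_eq_iff gf)
  moreover have "g \<in> carrier cantor_homeo"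
    using homeomorphism_symD[OF g] by (auto simp: cantor_homeo_def)
  moreover have "inv\<^bsub>cantor_homeo\<^esub> f = g"
    using group.inv_equality[OF group_cantor_homeo _ assms \<open>g \<in> carrier cantor_homeo\<close>] gf
    by (simp add: cantor_homeo_def fun_eq_iff)
  ultimately show ?thesis by simp
qed

text \<open>The supremum is a maximum, see \<open>homeo_dist_attained\<close>.\<close>

definition homeo_dist :: "(cantor \<Rightarrow> cantor) \<Rightarrow> (cantor \<Rightarrow> cantor) \<Rightarrow> real" where
  "homeo_dist f g = (SUP \<sigma>. cantor_dist (f \<sigma>) (g \<sigma>))"

lemma bdd_above_cantor_dist: "bdd_above (range (\<lambda>\<sigma>. cantor_dist (f \<sigma>) (g \<sigma>)))"
  by (rule bdd_aboveI[of _ 1]) (auto simp: cantor_dist_le_1)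

lemma cantor_dist_le_homeo_dist: "cantor_dist (f \<sigma>) (g \<sigma>) \<le> homeo_dist f g"
  unfolding homeo_dist_def by (rule cSUP_upper[OF UNIV_I bdd_above_cantor_dist])

lemma homeo_dist_attained: "\<exists>\<sigma>. homeo_dist f g = cantor_dist (f \<sigma>) (g \<sigma>)"
proof (cases "f = g")
  case True
  then show ?thesis by (simp add: homeo_dist_def)
next
  case False
  define P where "P n \<longleftrightarrow> (\<exists>\<sigma>. f \<sigma> n \<noteq> g \<sigma> n)" for n
  define k where "k = (LEAST n. P n)"
  have "\<exists>n. P n" using False unfolding P_def fun_eq_iff by blast
  then have "P k" and min: "\<And>n. n < k \<Longrightarrow> \<not> P n"
    unfolding k_def using LeastI_ex not_less_Least by blast+
  then obtain \<sigma> where \<sigma>: "f \<sigma> k \<noteq> g \<sigma> k" unfolding P_def by blast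
  have "cantor_dist (f \<tau>) (g \<tau>) \<le> cantor_dist (f \<sigma>) (g \<sigma>)" for \<tau>
  proof -
    have ge: "1 / real (Suc k) \<le> cantor_dist (f \<sigma>) (g \<sigma>)"
      using \<sigma> cantor_dist_less_iff[of "f \<sigma>" "g \<sigma>" k] by (meson not_less order_refl)
    have "cantor_dist (f \<tau>) (g \<tau>) \<le> 1 / real (Suc k)"
    proof (cases "f \<tau> = g \<tau>")
      case False
      then have "\<exists>n. f \<tau> n \<noteq> g \<tau> n" by auto
      from LeastI_ex[OF this] have "P (LEAST n. f \<tau> n \<noteq> g \<tau> n)" unfolding P_def by blast
      then have "k \<le> (LEAST n. f \<tau> n \<noteq> g \<tau> n)" using min by (meson not_less)
      then show ?thesis using False by (simp add: cantor_dist_def frac_le)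
    qed (simp add: cantor_dist_def)
    with ge show ?thesis by linarith
  qed
  then have "homeo_dist f g \<le> cantor_dist (f \<sigma>) (g \<sigma>)"
    unfolding homeo_dist_def by (intro cSUP_least) auto
  then show ?thesis using cantor_dist_le_homeo_dist[of f \<sigma> g] by (intro exI[of _ \<sigma>]) simp
qed

interpretation Homeo: Metric_space "carrier cantor_homeo" homeo_dist
proof
  fix f g h :: "cantor \<Rightarrow> cantor"
  show "0 \<le> homeo_dist f g"
    using homeo_dist_attained[of f g] cantor_dist_nonneg by auto
  show "homeo_dist f g = homeo_dist g f"
    by (simp add: homeo_dist_def cantor_dist_commute)
  show "homeo_dist f g = 0 \<longleftrightarrow> f = g"
  proof
    assume "homeo_dist f g = 0"
    then have "cantor_dist (f \<sigma>) (g \<sigma>) = 0" for \<sigma>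
      using cantor_dist_le_homeo_dist[of f \<sigma> g] cantor_dist_nonneg[of "f \<sigma>" "g \<sigma>"] by simp
    then show "f = g" by auto
  next
    assume "f = g"
    then show "homeo_dist f g = 0" by (simp add: homeo_dist_def)
  qed
  show "homeo_dist f h \<le> homeo_dist f g + homeo_dist g h"
  proof -
    obtain \<sigma> where "homeo_dist f h = cantor_dist (f \<sigma>) (h \<sigma>)"
      using homeo_dist_attained by blast
    also have "\<dots> \<le> cantor_dist (f \<sigma>) (g \<sigma>) + cantor_dist (g \<sigma>) (h \<sigma>)"
      by (rule Cantor.triangle) auto
    also have "\<dots> \<le> homeo_dist f g + homeo_dist g h"
      by (intro add_mono cantor_dist_le_homeo_dist)
    finally show ?thesis .
  qed
qed

text \<open>A comeager conjugacy class is unique if it exists, so ``the'' comeager conjugacy class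
  is an arbitrary set with this property.\<close>

definition comeager_conjugacy_class :: "(cantor \<Rightarrow> cantor) set \<Rightarrow> bool" where
  "comeager_conjugacy_class C \<longleftrightarrow>
     (\<exists>f\<in>carrier cantor_homeo. C = conjugacy_class cantor_homeo f) \<and>
     comeager_in Homeo.mtopology C"

end

theory Submission
  imports Defs
begin

text \<open>
  All three claims follow from one combinatorial property of \<open>h\<close>, which is invariant under
  conjugation and holds for a comeager set of homeomorphisms, hence for every element of a
  comeager conjugacy class.

  The property says that \<open>h\<close> has a \<^emph>\<open>two-phase structure\<close> at every scale (locale
  \<open>two_phase\<close>, predicate \<open>two_phase_at_all_scales\<close>). Such a structure consists of a locally
  constant labelling \<open>l\<close> of the space that is fine enough for the scale, a clopen set \<open>U\<close> of
  upstream points, and a clopen invariant set \<open>J\<close>. Points can pass from \<open>U\<close> to its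
  complement but not back. Upstream, the label of a point determines the label of its preimage;
  downstream, the label of a point determines the label of its image. Every transition between
  labels that occurs at all also occurs while crossing from \<open>U\<close> to its complement, both
  inside and outside \<open>J\<close>. In the graph of transitions between labelled pieces, ways back are
  unique in \<open>U\<close> and ways forward are unique in its complement, much as in a union of dumbbells
  where loops on the left lead over bars to loops on the right.

  \<^emph>\<open>Genericity.\<close> A structure persists under small perturbations. To find one near a given
  homeomorphism \<open>h\<close>, take prefixes as labels, choose for every prefix one successor and one
  predecessor in the transition graph of \<open>h\<close>, and let the new map use only the chosen
  predecessors upstream and only the chosen successors downstream, while all transitions are used
  for crossing. Since nonempty clopen sets are homeomorphic to each other, any such pattern of
  transitions is realised by a homeomorphism (\<open>homeomorphism_with_labels\<close>), and it is close to
  \<open>h\<close> because it gives the image of every point the prefix that \<open>h\<close> gives it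
  (\<open>two_phase_perturbation\<close>). The Baire category theorem in the homeomorphism group finishes
  the argument.

  \<^emph>\<open>Chain continuity.\<close> If the orbit of \<open>x\<close> stayed in \<open>U\<close>, two of its labels would agree
  by finiteness, and going backwards the label of \<open>x\<close> itself would return. So the orbit of a
  nonrecurrent point enters the complement of \<open>U\<close> for a fine enough structure. Up to that time a
  chain follows the orbit by continuity, and afterwards the labels of chain and orbit are both
  determined by the same successor rule (\<open>nonrecurrent_chain_continuous\<close>). A point of \<open>U\<close>
  with image outside \<open>U\<close> never comes near itself again, and such points are dense.

  \<^emph>\<open>Failure of equicontinuity.\<close> Fix one structure. A point whose orbit stays in \<open>U\<close>, but
  which is a limit of points whose orbits leave \<open>U\<close>, is not a point of equicontinuity. By
  compactness such a point exists in every intersection of a decreasing sequence of clopen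
  invariant sets on each of which crossing occurs (\<open>frontier_meets_nested\<close>). Each such set is
  cut in two sets of the same kind by the set \<open>J\<close> of a finer structure, which gives a binary
  tree and, along its branches, uncountably many points.
\<close>

section \<open>Prefixes and dependence on finitely many coordinates\<close>

text \<open>The prefix of length \<open>k\<close>, padded with \<open>False\<close>. A prefix is thus itself a point of the
  cylinder that it stands for, and maps of the Cantor space can be applied to it.\<close>

definition trunc :: "nat \<Rightarrow> cantor \<Rightarrow> cantor" where
  "trunc k x = (\<lambda>i. i < k \<and> x i)"

lemma trunc_eq_iff: "trunc k x = trunc k y \<longleftrightarrow> (\<forall>i<k. x i = y i)"
  by (auto simp: trunc_def fun_eq_iff)

lemma trunc_trunc [simp]: "trunc k (trunc k x) = trunc k x"
  by (auto simp: trunc_def fun_eq_iff)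

lemma trunc_eq_mono: "trunc m x = trunc m y \<Longrightarrow> k \<le> m \<Longrightarrow> trunc k x = trunc k y"
  by (simp add: trunc_eq_iff)

lemma trunc_ext: "(\<And>k. trunc k x = trunc k y) \<Longrightarrow> x = y"
  unfolding trunc_eq_iff by (rule ext) blast

lemma cantor_dist_less_iff_trunc:
  "cantor_dist x y < 1 / real (Suc k) \<longleftrightarrow> trunc (Suc k) x = trunc (Suc k) y"
  by (simp only: cantor_dist_less_iff trunc_eq_iff less_Suc_eq_le)

lemma finite_range_trunc: "finite (range (trunc k))"
proof (rule finite_subset)
  show "range (trunc k) \<subseteq> (\<lambda>S i. i \<in> S) ` Pow {..<k}"
  proof (rule image_subsetI)
    fix x
    have "trunc k x = (\<lambda>i. i \<in> {i. i < k \<and> x i})" by (simp add: trunc_def)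
    then show "trunc k x \<in> (\<lambda>S i. i \<in> S) ` Pow {..<k}" by (rule image_eqI) blast
  qed
qed simp

text \<open>Locally constant maps are handled through a common bound for the coordinates that they
  depend on. A set \<open>A\<close> is clopen exactly if its membership predicate has such a bound.\<close>

definition depth_le :: "nat \<Rightarrow> (cantor \<Rightarrow> 'b) \<Rightarrow> bool" where
  "depth_le m f \<longleftrightarrow> (\<forall>x y. trunc m x = trunc m y \<longrightarrow> f x = f y)"

lemma depth_leD: "depth_le m f \<Longrightarrow> trunc m x = trunc m y \<Longrightarrow> f x = f y"
  unfolding depth_le_def by blast

lemma depth_le_mono: "depth_le m f \<Longrightarrow> m \<le> n \<Longrightarrow> depth_le n f"
  unfolding depth_le_def by (blast intro: trunc_eq_mono)

lemma depth_le_comp: "depth_le m f \<Longrightarrow> depth_le m (\<lambda>x. F (f x))"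
  unfolding depth_le_def by (intro allI impI arg_cong[of _ _ F]) blast

lemma open_trunc_cylinder: "open {y. trunc m y = trunc m x}"
proof -
  have "{y. trunc m y = trunc m x} = PiE UNIV (\<lambda>i. if i < m then {x i} else UNIV)"
    by (auto simp: trunc_eq_iff PiE_UNIV_domain split: if_splits)
  then show ?thesis
    by (auto intro!: open_PiE open_discrete)
qed

lemma open_contains_cylinder:
  assumes "open U" "x \<in> U"
  obtains m where "\<And>y. trunc m y = trunc m x \<Longrightarrow> y \<in> U"
proof -
  have "openin Cantor.mtopology U"
    using assms(1) by (simp add: Cantor_mtopology)
  then obtain r where r: "r > 0" "Cantor.mball x r \<subseteq> U"
    using assms(2) unfolding Cantor.openin_mtopology by blast
  obtain k where k: "1 / real (Suc k) < r"
    using r(1) by (rule nat_approx_posE)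
  have "y \<in> U" if "trunc (Suc k) y = trunc (Suc k) x" for y
  proof -
    have "cantor_dist x y < 1 / real (Suc k)"
      unfolding cantor_dist_less_iff_trunc using that by simp
    then have "y \<in> Cantor.mball x r" using k by simp
    then show ?thesis using r(2) by blast
  qed
  then show ?thesis by (rule that)
qed

lemma depth_le_open:
  assumes "depth_le m f"
  shows "open {x. P (f x)}"
proof (subst open_subopen, intro ballI)
  fix x assume "x \<in> {x. P (f x)}"
  then have "{y. trunc m y = trunc m x} \<subseteq> {x. P (f x)}"
    using depth_leD[OF assms] by (metis (mono_tags, lifting) mem_Collect_eq subsetI)
  then show "\<exists>T. open T \<and> x \<in> T \<and> T \<subseteq> {x. P (f x)}"
    using open_trunc_cylinder by blast
qed

lemma depth_le_closed:
  assumes "depth_le m f"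
  shows "closed {x. P (f x)}"
  using depth_le_open[OF assms, of "\<lambda>c. \<not> P c"] by (simp add: closed_def Collect_neg_eq)

lemma compact_UNIV_cantor: "compact (UNIV :: cantor set)"
proof -
  have "compact_space (euclidean :: bool topology)"
    by (simp add: compact_space_def finite_imp_compact)
  then have "compact_space (product_topology (\<lambda>i::nat. euclidean :: bool topology) UNIV)"
    by (simp add: compact_space_product_topology)
  then show ?thesis
    by (simp add: euclidean_product_topology compact_space_def)
qed

text \<open>This is uniform continuity: finitely many cylinders on which the prefix of the image is
  constant cover the space, and the longest of their lengths works everywhere.\<close>

lemma continuous_depth:
  assumes "continuous_on UNIV (h :: cantor \<Rightarrow> cantor)"
  obtains m where "depth_le m (\<lambda>x. trunc k (h x))"
proof -
  have "\<exists>m. \<forall>y. trunc m y = trunc m x \<longrightarrow> trunc k (h y) = trunc k (h x)" for x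
  proof -
    have "open (h -` {y. trunc k y = trunc k (h x)})"
      using assms open_trunc_cylinder by (metis continuous_on_open_vimage inf_top_right open_UNIV)
    moreover have "x \<in> h -` {y. trunc k y = trunc k (h x)}" by simp
    ultimately obtain m where "\<And>y. trunc m y = trunc m x \<Longrightarrow> y \<in> h -` {y. trunc k y = trunc k (h x)}"
      by (rule open_contains_cylinder) (rule that)
    then show ?thesis unfolding vimage_def mem_Collect_eq by blast
  qed
  then obtain m where m: "\<And>x y. trunc (m x) y = trunc (m x) x \<Longrightarrow> trunc k (h y) = trunc k (h x)"
    by metis
  define N where "N x = {y. trunc (m x) y = trunc (m x) x}" for x
  have "open (N x)" "x \<in> N x" for x
    by (auto simp: N_def open_trunc_cylinder)
  then obtain X where X: "finite X" "UNIV \<subseteq> (\<Union>x\<in>X. N x)"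
    using compactE_image[OF compact_UNIV_cantor, of UNIV N] by (metis UNIV_I UN_I subsetI)
  have "depth_le (Max (m ` X)) (\<lambda>x. trunc k (h x))"
    unfolding depth_le_def
  proof (intro allI impI)
    fix y z assume yz: "trunc (Max (m ` X)) y = trunc (Max (m ` X)) z"
    obtain x where x: "x \<in> X" "y \<in> N x" using X(2) by blast
    have "m x \<le> Max (m ` X)" using x(1) X(1) by simp
    then have "trunc (m x) z = trunc (m x) y" using yz trunc_eq_mono by metis
    then show "trunc k (h y) = trunc k (h z)"
      using m x(2) unfolding N_def by (metis mem_Collect_eq)
  qed
  then show ?thesis by (rule that)
qed

lemma continuous_if_depth:
  assumes "\<And>k. \<exists>m. depth_le m (\<lambda>x. trunc k (h x))"
  shows "continuous_on UNIV (h :: cantor \<Rightarrow> cantor)"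
  unfolding continuous_on_open_vimage[OF open_UNIV]
proof (intro allI impI, subst open_subopen, intro ballI)
  fix B :: "cantor set" and x assume B: "open B" and "x \<in> h -` B \<inter> UNIV"
  then have "h x \<in> B" by simp
  from B this obtain k where k: "\<And>y. trunc k y = trunc k (h x) \<Longrightarrow> y \<in> B"
    by (rule open_contains_cylinder) blast
  obtain m where "depth_le m (\<lambda>x. trunc k (h x))" using assms by blast
  then have "open {y. trunc k (h y) = trunc k (h x)}" by (rule depth_le_open)
  then show "\<exists>T. open T \<and> x \<in> T \<and> T \<subseteq> h -` B \<inter> UNIV"
    by (intro exI[of _ "{y. trunc k (h y) = trunc k (h x)}"] conjI subsetI IntI vimageI2)
      (simp_all add: k)
qed

section \<open>Homeomorphisms with prescribed labels\<close>

text \<open>Pieces with open fibres of a labelling can be glued, since continuity only has to be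
  checked on each fibre.\<close>

lemma homeomorphism_glue:
  fixes A :: "'a::topological_space set" and B :: "'b::topological_space set"
    and \<alpha> :: "'a \<Rightarrow> 'l" and \<beta> :: "'b \<Rightarrow> 'l"
  assumes "\<And>l. open (\<alpha> -` {l})" "\<And>l. open (\<beta> -` {l})"
    and hom: "\<And>l. homeomorphism (A \<inter> \<alpha> -` {l}) (B \<inter> \<beta> -` {l}) (\<phi> l) (\<psi> l)"
  shows "homeomorphism A B (\<lambda>x. \<phi> (\<alpha> x) x) (\<lambda>y. \<psi> (\<beta> y) y)"
proof -
  have glue: "continuous_on A (\<lambda>x. \<phi> (\<alpha> x) x)"
    if op: "\<And>l. open (\<alpha> -` {l})" and cont: "\<And>l. continuous_on (A \<inter> \<alpha> -` {l}) (\<phi> l)"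
    for A :: "'c::topological_space set" and \<alpha> :: "'c \<Rightarrow> 'l" and \<phi> :: "'l \<Rightarrow> 'c \<Rightarrow> 'd::topological_space"
    unfolding continuous_on_topological
  proof (intro ballI allI impI)
    fix x C assume "x \<in> A" "open C" "\<phi> (\<alpha> x) x \<in> C"
    moreover from \<open>x \<in> A\<close> have "x \<in> A \<inter> \<alpha> -` {\<alpha> x}" by simp
    ultimately obtain T where "open T" "x \<in> T"
        "\<forall>y\<in>A \<inter> \<alpha> -` {\<alpha> x}. y \<in> T \<longrightarrow> \<phi> (\<alpha> x) y \<in> C"
      using cont[of "\<alpha> x"] unfolding continuous_on_topological by blast
    then show "\<exists>T. open T \<and> x \<in> T \<and> (\<forall>y\<in>A. y \<in> T \<longrightarrow> \<phi> (\<alpha> y) y \<in> C)"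
      using op[of "\<alpha> x"] by (intro exI[of _ "T \<inter> \<alpha> -` {\<alpha> x}"]) auto
  qed
  have ab: "\<phi> (\<alpha> x) x \<in> B \<and> \<beta> (\<phi> (\<alpha> x) x) = \<alpha> x \<and> \<psi> (\<alpha> x) (\<phi> (\<alpha> x) x) = x" if "x \<in> A" for x
    using hom[of "\<alpha> x"] that unfolding homeomorphism_def by blast
  have ba: "\<psi> (\<beta> y) y \<in> A \<and> \<alpha> (\<psi> (\<beta> y) y) = \<beta> y \<and> \<phi> (\<beta> y) (\<psi> (\<beta> y) y) = y" if "y \<in> B" for y
    using hom[of "\<beta> y"] that unfolding homeomorphism_def by blast
  show ?thesis
  proof (rule homeomorphismI)
    show "continuous_on A (\<lambda>x. \<phi> (\<alpha> x) x)"
      by (rule glue[OF assms(1)]) (rule homeomorphism_cont1[OF hom])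
    show "continuous_on B (\<lambda>y. \<psi> (\<beta> y) y)"
      by (rule glue[OF assms(2)]) (rule homeomorphism_cont2[OF hom])
  qed (use ab ba in auto)
qed

lemma homeomorphism_cons:
  "homeomorphism A (case_nat b ` A) (case_nat b) (\<lambda>x i. x (Suc i))" for A :: "cantor set"
proof (rule homeomorphismI)
  show "continuous_on A (case_nat b :: cantor \<Rightarrow> cantor)"
  proof (rule continuous_on_coordinatewise_then_product)
    fix i show "continuous_on A (\<lambda>x :: cantor. case_nat b x i)"
      by (cases i) (auto intro: continuous_on_subset[OF continuous_on_product_coordinates])
  qed
  show "continuous_on (case_nat b ` A) (\<lambda>(x::cantor) i. x (Suc i))"
    by (rule continuous_on_coordinatewise_then_product)
      (auto intro: continuous_on_subset[OF continuous_on_product_coordinates])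
qed auto

text \<open>Induction on the number of coordinates that \<open>A\<close> depends on: the first coordinate cuts
  \<open>A\<close> and the whole space into two halves, each half of \<open>A\<close> is empty or, by induction, a copy of
  the whole space, and two nonempty halves are glued.\<close>

lemma clopen_homeomorphic_UNIV:
  assumes "depth_le d (\<lambda>x. x \<in> A)" "A \<noteq> {}"
  shows "A homeomorphic (UNIV :: cantor set)"
  using assms
proof (induction d arbitrary: A)
  case 0
  then have "A = UNIV" by (auto simp: depth_le_def trunc_def)
  then show ?case by (simp add: homeomorphic_refl)
next
  case (Suc d)
  define B where "B b = {y. case_nat b y \<in> A}" for b
  define P where "P b = A \<inter> (\<lambda>x. x 0) -` {b}" for b
  define Q where "Q b = UNIV \<inter> (\<lambda>x :: cantor. x 0) -` {b}" for b
  have img: "P b = case_nat b ` B b" "Q b = case_nat b ` UNIV" for b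
  proof -
    have "x \<in> case_nat b ` C \<longleftrightarrow> x 0 = b \<and> (\<lambda>i. x (Suc i)) \<in> C"
      for x :: cantor and C
    proof -
      have "x = case_nat b (\<lambda>i. x (Suc i))" if "x 0 = b"
        using that by (simp add: fun_eq_iff split: nat.split)
      then show ?thesis by auto
    qed
    note mem = this
    have eq: "case_nat b (\<lambda>i. x (Suc i)) = x" if "x 0 = b" for x :: cantor
      using that by (simp add: fun_eq_iff split: nat.split)
    show "P b = case_nat b ` B b"
      unfolding set_eq_iff mem P_def B_def Int_iff vimage_singleton_eq mem_Collect_eq
      using eq by metis
    show "Q b = case_nat b ` UNIV"
      unfolding set_eq_iff mem by (auto simp: Q_def)
  qed
  have "depth_le d (\<lambda>x. x \<in> B b)" for b
    unfolding depth_le_def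
  proof (intro allI impI)
    fix x y assume "trunc d x = trunc d y"
    then have "trunc (Suc d) (case_nat b x) = trunc (Suc d) (case_nat b y)"
      by (auto simp: trunc_eq_iff split: nat.splits)
    then show "(x \<in> B b) = (y \<in> B b)"
      unfolding B_def using depth_leD[OF Suc.prems(1)] by blast
  qed
  then have B: "B b homeomorphic (UNIV :: cantor set)" if "B b \<noteq> {}" for b
    using Suc.IH that by blast
  have cons: "C homeomorphic case_nat b ` C" for b and C :: "cantor set"
    using homeomorphism_cons unfolding homeomorphic_def by blast
  have PU: "P b homeomorphic (UNIV :: cantor set)" if "P b \<noteq> {}" for b
    using that B[of b] cons[of "B b" b] unfolding img(1)
    by (metis homeomorphic_sym homeomorphic_trans image_is_empty)
  show ?case
  proof (cases "P True = {} \<or> P False = {}")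
    case True
    moreover have "A = P True \<union> P False" by (auto simp: P_def)
    ultimately obtain b where "A = P b" by auto
    then show ?thesis using PU Suc.prems(2) by metis
  next
    case False
    then have "P b homeomorphic Q b" for b
      using PU[of b] cons[of UNIV b] unfolding img(2)
      by (metis (full_types) homeomorphic_trans)
    then have "\<forall>b. \<exists>\<phi> \<psi>. homeomorphism (P b) (Q b) \<phi> \<psi>"
      unfolding homeomorphic_def by blast
    then obtain \<phi> \<psi> where "\<And>b. homeomorphism (P b) (Q b) (\<phi> b) (\<psi> b)" by metis
    moreover have "open ((\<lambda>x :: cantor. x 0) -` {b})" for b
      using depth_le_open[of "Suc 0" "\<lambda>x :: cantor. x 0" "\<lambda>c. c = b"]
      by (simp add: depth_le_def trunc_eq_iff vimage_def)
    ultimately show ?thesis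
      unfolding P_def Q_def homeomorphic_def by (blast intro: homeomorphism_glue)
  qed
qed

text \<open>For every label, the points that have to be sent to it and the points that carry it form
  clopen sets that are either both empty or both nonempty. In the second case they are homeomorphic.\<close>

lemma homeomorphism_with_labels:
  fixes \<alpha> \<beta> :: "cantor \<Rightarrow> 'l"
  assumes \<alpha>: "depth_le d \<alpha>" and \<beta>: "depth_le d \<beta>" and range: "range \<alpha> = range \<beta>"
  obtains g g' where "homeomorphism UNIV UNIV g g'" "\<And>x. \<beta> (g x) = \<alpha> x"
proof -
  have "UNIV \<inter> \<alpha> -` {l} homeomorphic (UNIV \<inter> \<beta> -` {l} :: cantor set)" for l
  proof (cases "l \<in> range \<alpha>")
    case True
    moreover from this have "l \<in> range \<beta>" by (simp only: range)
    ultimately obtain x y where "x \<in> \<alpha> -` {l}" "y \<in> \<beta> -` {l}"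
      unfolding vimage_singleton_eq image_iff by metis
    then have "\<alpha> -` {l} \<noteq> {}" "\<beta> -` {l} \<noteq> {}"
      unfolding atomize_conj ex_in_conv[symmetric] by (intro conjI exI)
    moreover have "depth_le d (\<lambda>x. x \<in> \<alpha> -` {l})" "depth_le d (\<lambda>x. x \<in> \<beta> -` {l})"
      using depth_le_comp[OF \<alpha>, of "\<lambda>c. c = l"] depth_le_comp[OF \<beta>, of "\<lambda>c. c = l"]
      by simp_all
    ultimately have "\<alpha> -` {l} homeomorphic (UNIV :: cantor set)"
        "\<beta> -` {l} homeomorphic (UNIV :: cantor set)"
      by (blast intro: clopen_homeomorphic_UNIV)+
    then show ?thesis
      unfolding Int_UNIV_left by (meson homeomorphic_sym homeomorphic_trans)
  next
    case False
    then have "\<alpha> -` {l} = {}" by blast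
    moreover have "l \<notin> range \<beta>" using False by (simp only: range not_False_eq_True)
    then have "\<beta> -` {l} = {}" by blast
    ultimately show ?thesis by simp
  qed
  then have "\<forall>l. \<exists>\<phi> \<psi>. homeomorphism (UNIV \<inter> \<alpha> -` {l}) (UNIV \<inter> \<beta> -` {l}) \<phi> \<psi>"
    unfolding homeomorphic_def by blast
  then obtain \<phi> \<psi> where hom:
      "\<And>l. homeomorphism (UNIV \<inter> \<alpha> -` {l}) (UNIV \<inter> \<beta> -` {l}) (\<phi> l) (\<psi> l)"
    by metis
  show ?thesis
  proof (rule that)
    show "homeomorphism UNIV UNIV (\<lambda>x. \<phi> (\<alpha> x) x) (\<lambda>y. \<psi> (\<beta> y) y)"
    proof (rule homeomorphism_glue[OF _ _ hom])
      show "open (\<alpha> -` {l})" "open (\<beta> -` {l})" for l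
        using depth_le_open[OF \<alpha>, of "\<lambda>c. c = l"] depth_le_open[OF \<beta>, of "\<lambda>c. c = l"]
        by (simp_all add: vimage_def)
    qed
    show "\<beta> (\<phi> (\<alpha> x) x) = \<alpha> x" for x
      using hom[of "\<alpha> x"] unfolding homeomorphism_def by blast
  qed
qed

section \<open>Two-phase structures\<close>

text \<open>All assumptions on \<open>g\<close> concern the labels and positions of \<open>x\<close> and \<open>g x\<close>, never the
  inverse of \<open>g\<close>; in this form they are stable under perturbation of \<open>g\<close> alone. In \<open>crossing\<close>,
  that every transition of labels occurs between \<open>U\<close> and its complement makes the crossing points
  dense at fine scales, and that it occurs on both sides of \<open>J\<close> makes it possible to split
  invariant sets.\<close>

locale two_phase =
  fixes g l :: "cantor \<Rightarrow> cantor" and U J :: "cantor set"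
  assumes finite_depth: "\<exists>m. depth_le m (\<lambda>x. (l x, x \<in> U, x \<in> J))"
    and invariant: "g x \<in> J \<longleftrightarrow> x \<in> J"
    and backward_closed: "g x \<in> U \<Longrightarrow> x \<in> U"
    and forward_det: "x \<notin> U \<Longrightarrow> y \<notin> U \<Longrightarrow> l x = l y \<Longrightarrow> l (g x) = l (g y)"
    and backward_det: "g x \<in> U \<Longrightarrow> g y \<in> U \<Longrightarrow> l (g x) = l (g y) \<Longrightarrow> l x = l y"
    and crossing: "\<exists>y. l y = l x \<and> l (g y) = l (g x) \<and> y \<in> U \<and> g y \<notin> U \<and> (y \<in> J \<longleftrightarrow> i)"

definition refines :: "(cantor \<Rightarrow> 'b) \<Rightarrow> nat \<Rightarrow> bool" where
  "refines l n \<longleftrightarrow> (\<forall>x y. l x = l y \<longrightarrow> trunc n x = trunc n y)"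

lemma refinesD: "refines l n \<Longrightarrow> l x = l y \<Longrightarrow> trunc n x = trunc n y"
  unfolding refines_def by blast

text \<open>The assumptions speak about \<open>g x\<close> only through its label and its membership in \<open>U\<close> and \<open>J\<close>,
  which depend on a bounded prefix of \<open>g x\<close>.\<close>

lemma two_phase_stable:
  assumes "two_phase g l U J"
  obtains m where "\<And>g'. (\<And>x. trunc m (g' x) = trunc m (g x)) \<Longrightarrow> two_phase g' l U J"
proof -
  interpret two_phase g l U J by fact
  obtain m where m: "depth_le m (\<lambda>x. (l x, x \<in> U, x \<in> J))" using finite_depth by blast
  have "two_phase g' l U J" if "\<And>x. trunc m (g' x) = trunc m (g x)" for g'
  proof -
    have "(l (g' x), g' x \<in> U, g' x \<in> J) = (l (g x), g x \<in> U, g x \<in> J)" for x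
      by (rule depth_leD[OF m]) (rule that)
    then have eq: "l (g' x) = l (g x)" "g' x \<in> U \<longleftrightarrow> g x \<in> U" "g' x \<in> J \<longleftrightarrow> g x \<in> J" for x
      by simp_all
    show ?thesis
      using finite_depth invariant backward_closed forward_det backward_det crossing
      by unfold_locales (unfold eq, assumption?, blast+)
  qed
  then show ?thesis by (rule that)
qed

section \<open>Approximating a homeomorphism by two-phase ones\<close>

text \<open>Take prefixes of length \<open>k\<close> as labels, and let \<open>m\<close> be so large that the first \<open>m\<close>
  coordinates of \<open>x\<close> determine the labels of \<open>x\<close> and \<open>h x\<close>. The next three coordinates
  are free: coordinate \<open>m\<close> defines \<open>J\<close>, and the other two distribute the points of each
  transition \<open>(q, q')\<close> over the available types. The type \<open>upstream to upstream\<close> (the set \<open>V\<close>) is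
  available if \<open>q\<close> is the chosen predecessor of \<open>q'\<close>, the type
  \<open>downstream to downstream\<close> (the set \<open>D\<close>) if \<open>q'\<close> is the chosen successor of \<open>q\<close>,
  and crossing is always available. The chosen successor of a prefix is read off from the
  image of the padded prefix, the chosen predecessor from its preimage. The map \<open>g\<close> then has to
  send \<open>x\<close> to a point with the label of \<open>h x\<close>, on the same side of \<open>J\<close>, that is upstream
  exactly if \<open>x\<close> is in \<open>V\<close>.\<close>

lemma two_phase_perturbation:
  assumes h: "homeomorphism UNIV UNIV h h'"
  obtains g g' U J where "homeomorphism UNIV UNIV g g'"
    "\<And>x. trunc k (g x) = trunc k (h x)" "two_phase g (trunc k) U J"
proof -
  have hh': "h (h' x) = x" for x using h by (simp add: homeomorphism_def)
  obtain m0 where m0: "depth_le m0 (\<lambda>x. trunc k (h x))"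
    using continuous_depth homeomorphism_cont1[OF h] by blast
  define m where "m = max m0 k"
  have hm: "trunc k (h x) = trunc k (h y)" and km: "trunc k x = trunc k y"
    if "trunc m x = trunc m y" for x y
    using that depth_leD[OF depth_le_mono[OF m0]] trunc_eq_mono unfolding m_def
    by (blast intro: max.cobounded1 max.cobounded2)+
  define set3 where "set3 x a b c = x(m := a, Suc m := b, Suc (Suc m) := c)"
    for x :: cantor and a b c
  have set3: "trunc m (set3 x a b c) = trunc m x" "set3 x a b c m = a"
      "set3 x a b c (Suc m) = b" "set3 x a b c (Suc (Suc m)) = c" for x a b c
    by (auto simp: set3_def trunc_eq_iff)
  have set3_k: "trunc k (set3 x a b c) = trunc k x"
      "trunc k (h (set3 x a b c)) = trunc k (h x)" for x a b c
    by (rule km hm, rule set3)+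
  define V where
    "V = {x. trunc k (h' (trunc k (h x))) = trunc k x \<and> x (Suc m) \<and> x (Suc (Suc m))}"
  define D where
    "D = {x. trunc k (h (trunc k x)) = trunc k (h x) \<and> x (Suc m) \<and> \<not> x (Suc (Suc m))}"
  define J where "J = {x :: cantor. x m}"
  define \<alpha> where "\<alpha> x = (trunc k (h x), x \<in> J, x \<in> V)" for x
  define \<beta> where "\<beta> x = (trunc k x, x \<in> J, x \<in> - D)" for x
  have depth: "\<alpha> x = \<alpha> y \<and> \<beta> x = \<beta> y \<and> (trunc k x, x \<in> - D, x \<in> J) = (trunc k y, y \<in> - D, y \<in> J)"
    if xy: "trunc (m + 3) x = trunc (m + 3) y" for x y
  proof -
    have "trunc m x = trunc m y" by (rule trunc_eq_mono[OF xy]) simp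
    then have 1: "trunc k (h x) = trunc k (h y)" and 2: "trunc k x = trunc k y"
      by (rule hm, rule km)
    have 3: "x m = y m" "x (Suc m) = y (Suc m)" "x (Suc (Suc m)) = y (Suc (Suc m))"
      using xy by (simp_all add: trunc_eq_iff)
    show ?thesis
      unfolding \<alpha>_def \<beta>_def V_def D_def J_def mem_Collect_eq Compl_iff 1 2 3 by simp
  qed
  have "range \<alpha> \<subseteq> range \<beta>"
  proof (rule image_subsetI)
    fix x
    define y where "y = set3 (trunc k (h x)) (x m) (x \<notin> V) False"
    \<comment> \<open>The transition from the padded prefix is the chosen one, so the two
      type coordinates decide alone whether \<open>y\<close> lies in \<open>D\<close>.\<close>
    have "\<alpha> x = \<beta> y"
      by (simp add: \<alpha>_def \<beta>_def y_def J_def D_def set3 set3_k)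
    then show "\<alpha> x \<in> range \<beta>" by (simp only: rangeI)
  qed
  moreover have "range \<beta> \<subseteq> range \<alpha>"
  proof (rule image_subsetI)
    fix y
    define x where "x = set3 (h' (trunc k y)) (y m) (y \<notin> D) (y \<notin> D)"
    \<comment> \<open>Likewise, the transition into the padded prefix of \<open>y\<close> from its preimage is the
      chosen one, so the type coordinates decide alone whether \<open>x\<close> lies in \<open>V\<close>.\<close>
    have "\<beta> y = \<alpha> x"
      by (simp add: \<alpha>_def \<beta>_def x_def J_def V_def set3 set3_k hh')
    then show "\<beta> y \<in> range \<alpha>" by (simp only: rangeI)
  qed
  ultimately have "range \<alpha> = range \<beta>" by (rule subset_antisym)
  moreover have "depth_le (m + 3) \<alpha>" "depth_le (m + 3) \<beta>"
    unfolding depth_le_def using depth by blast+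
  ultimately obtain g g' where g: "homeomorphism UNIV UNIV g g'" and \<beta>g: "\<And>x. \<beta> (g x) = \<alpha> x"
    using homeomorphism_with_labels by metis
  have gk: "trunc k (g x) = trunc k (h x)" and gJ: "g x \<in> J \<longleftrightarrow> x \<in> J"
      and gD: "g x \<in> - D \<longleftrightarrow> x \<in> V" for x
    using \<beta>g[of x] by (simp_all add: \<alpha>_def \<beta>_def)
  have "two_phase g (trunc k) (- D) J"
  proof
    show "\<exists>m. depth_le m (\<lambda>x. (trunc k x, x \<in> - D, x \<in> J))"
      unfolding depth_le_def using depth by blast
    show "g x \<in> J \<longleftrightarrow> x \<in> J" for x by (rule gJ)
    show "x \<in> - D" if "g x \<in> - D" for x
      using that unfolding gD by (auto simp: V_def D_def)
    show "trunc k (g x) = trunc k (g y)"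
      if "x \<notin> - D" "y \<notin> - D" "trunc k x = trunc k y" for x y
    proof -
      have "trunc k (h (trunc k x)) = trunc k (h x)" "trunc k (h (trunc k y)) = trunc k (h y)"
        using that(1,2) by (simp_all add: D_def)
      then show ?thesis using that(3) by (simp only: gk)
    qed
    show "trunc k x = trunc k y"
      if "g x \<in> - D" "g y \<in> - D" "trunc k (g x) = trunc k (g y)" for x y
    proof -
      have "trunc k (h' (trunc k (g x))) = trunc k x" "trunc k (h' (trunc k (g y))) = trunc k y"
        using that(1,2) unfolding gD gk by (simp_all add: V_def)
      then show ?thesis using that(3) by simp
    qed
    show "\<exists>y. trunc k y = trunc k x \<and> trunc k (g y) = trunc k (g x) \<and>
        y \<in> - D \<and> g y \<notin> - D \<and> (y \<in> J \<longleftrightarrow> i)" for x i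
      unfolding gD gk
      by (rule exI[of _ "set3 x i False False"]) (simp add: set3_k set3 D_def V_def J_def)
  qed
  with g gk show ?thesis by (rule that)
qed

section \<open>The homeomorphism group as a Baire space\<close>

lemma carrier_cantor_homeo_iff: "f \<in> carrier cantor_homeo \<longleftrightarrow> homeomorphism UNIV UNIV f (inv_into UNIV f)"
proof
  assume "f \<in> carrier cantor_homeo"
  then obtain g where g: "homeomorphism UNIV UNIV f g" by (auto simp: cantor_homeo_def)
  then have "f \<circ> g = id" "g \<circ> f = id" by (auto simp: homeomorphism_def)
  then have "inv_into UNIV f = g" by (rule inv_unique_comp)
  with g show "homeomorphism UNIV UNIV f (inv_into UNIV f)" by simp
qed (auto simp: cantor_homeo_def)

lemma carrier_cantor_homeoD:
  assumes "f \<in> carrier cantor_homeo"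
  shows "continuous_on UNIV f" "continuous_on UNIV (inv_into UNIV f)"
    "inv_into UNIV f (f x) = x" "f (inv_into UNIV f x) = x"
  using assms unfolding carrier_cantor_homeo_iff by (auto simp: homeomorphism_def)

lemma homeo_dist_less_iff:
  "homeo_dist f g < 1 / real (Suc k) \<longleftrightarrow> (\<forall>x. trunc (Suc k) (f x) = trunc (Suc k) (g x))"
  unfolding cantor_dist_less_iff_trunc[symmetric]
  using homeo_dist_attained[of f g] cantor_dist_le_homeo_dist[of f _ g] le_less_trans by metis

text \<open>The metric of uniform convergence is not complete on the homeomorphism group, because limits
  need not be injective. Controlling the inverses as well makes it complete without changing the
  topology.\<close>

definition homeo_dist2 :: "(cantor \<Rightarrow> cantor) \<Rightarrow> (cantor \<Rightarrow> cantor) \<Rightarrow> real" where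
  "homeo_dist2 f g = max (homeo_dist f g) (homeo_dist (inv_into UNIV f) (inv_into UNIV g))"

lemma inv_in_carrier_cantor_homeo: "f \<in> carrier cantor_homeo \<Longrightarrow> inv_into UNIV f \<in> carrier cantor_homeo"
  unfolding carrier_cantor_homeo_iff[of f] by (drule homeomorphism_symD) (auto simp: cantor_homeo_def)

interpretation Homeo2: Metric_space "carrier cantor_homeo" homeo_dist2
proof
  fix f g h :: "cantor \<Rightarrow> cantor"
  show "0 \<le> homeo_dist2 f g"
    by (simp add: homeo_dist2_def le_max_iff_disj)
  show "homeo_dist2 f g = homeo_dist2 g f"
    by (simp add: homeo_dist2_def Homeo.commute)
  assume fg: "f \<in> carrier cantor_homeo" "g \<in> carrier cantor_homeo"
  show "homeo_dist2 f g = 0 \<longleftrightarrow> f = g"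
  proof
    assume "homeo_dist2 f g = 0"
    then have "homeo_dist f g = 0"
      using Homeo.nonneg[of f g] unfolding homeo_dist2_def by linarith
    then show "f = g" using fg by simp
  next
    assume "f = g"
    then show "homeo_dist2 f g = 0"
      using fg inv_in_carrier_cantor_homeo by (simp add: homeo_dist2_def)
  qed
  assume h: "h \<in> carrier cantor_homeo"
  show "homeo_dist2 f h \<le> homeo_dist2 f g + homeo_dist2 g h"
    using Homeo.triangle[OF fg h]
      Homeo.triangle[OF fg[THEN inv_in_carrier_cantor_homeo] h[THEN inv_in_carrier_cantor_homeo]]
    unfolding homeo_dist2_def by linarith
qed

text \<open>Inversion is continuous: if \<open>g\<close> is close to \<open>f\<close>, then for \<open>x = inv g y\<close> the points \<open>f x\<close> and
  \<open>g x = y\<close> are close, and by uniform continuity of the inverse of \<open>f\<close> so are \<open>x\<close> and \<open>inv f y\<close>.\<close>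

lemma Homeo2_mtopology: "Homeo2.mtopology = Homeo.mtopology"
proof (rule topology_eq[THEN iffD2], intro allI iffI)
  fix W
  assume W: "openin Homeo.mtopology W"
  have "Homeo2.mball f r \<subseteq> Homeo.mball f r" for f r
    by (auto simp: homeo_dist2_def)
  with W show "openin Homeo2.mtopology W"
    unfolding Homeo.openin_mtopology Homeo2.openin_mtopology by (meson order_trans)
next
  fix W
  assume W: "openin Homeo2.mtopology W"
  have "\<exists>s>0. Homeo.mball f s \<subseteq> W" if "f \<in> W" for f
  proof -
    have f: "f \<in> carrier cantor_homeo" and "\<exists>r>0. Homeo2.mball f r \<subseteq> W"
      using W that unfolding Homeo2.openin_mtopology by blast+
    then obtain r where r: "r > 0" "Homeo2.mball f r \<subseteq> W" by blast
    obtain k where k: "1 / real (Suc k) < r" using r(1) by (rule nat_approx_posE)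
    obtain m where m: "depth_le m (\<lambda>x. trunc (Suc k) (inv_into UNIV f x))"
      using continuous_depth carrier_cantor_homeoD(2)[OF f] by blast
    define s where "s = 1 / real (Suc (max k m))"
    have "Homeo.mball f s \<subseteq> Homeo2.mball f r"
    proof
      fix g assume "g \<in> Homeo.mball f s"
      then have g: "g \<in> carrier cantor_homeo" and "homeo_dist f g < s" by simp_all
      then have fg: "trunc (Suc (max k m)) (f x) = trunc (Suc (max k m)) (g x)" for x
        unfolding s_def homeo_dist_less_iff by blast
      have "homeo_dist f g < 1 / real (Suc k)"
        unfolding homeo_dist_less_iff by (intro allI trunc_eq_mono[OF fg]) simp
      moreover have "trunc (Suc k) (inv_into UNIV f y) = trunc (Suc k) (inv_into UNIV g y)" for y
      proof -
        have "trunc m (f (inv_into UNIV g y)) = trunc m (g (inv_into UNIV g y))"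
          by (rule trunc_eq_mono[OF fg]) simp
        then have "trunc m (f (inv_into UNIV g y)) = trunc m y" by (simp only: carrier_cantor_homeoD(4)[OF g])
        then have "trunc (Suc k) (inv_into UNIV f (f (inv_into UNIV g y))) = trunc (Suc k) (inv_into UNIV f y)"
          by (rule depth_leD[OF m])
        then show ?thesis by (simp only: carrier_cantor_homeoD(3)[OF f])
      qed
      then have "homeo_dist (inv_into UNIV f) (inv_into UNIV g) < 1 / real (Suc k)"
        unfolding homeo_dist_less_iff by blast
      ultimately show "g \<in> Homeo2.mball f r"
        using f g k by (simp add: homeo_dist2_def)
    qed
    moreover have "s > 0" by (simp add: s_def)
    ultimately show ?thesis using r(2) by blast
  qed
  moreover have "W \<subseteq> carrier cantor_homeo"
    using W unfolding Homeo2.openin_mtopology by blast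
  ultimately show "openin Homeo.mtopology W"
    unfolding Homeo.openin_mtopology by blast
qed

lemma uniform_limit_trunc:
  fixes s :: "nat \<Rightarrow> cantor \<Rightarrow> cantor"
  assumes "\<And>k. \<exists>N. \<forall>n\<ge>N. \<forall>n'\<ge>N. \<forall>x. trunc k (s n x) = trunc k (s n' x)"
  obtains F where "\<And>k. \<exists>N. \<forall>n\<ge>N. \<forall>x. trunc k (s n x) = trunc k (F x)"
proof -
  obtain N where N: "\<And>k n n' x. n \<ge> N k \<Longrightarrow> n' \<ge> N k \<Longrightarrow> trunc k (s n x) = trunc k (s n' x)"
    using assms by metis
  \<comment> \<open>Coordinate \<open>i\<close> is stable from index \<open>N (Suc i)\<close> on.\<close>
  define F where "F x i = s (N (Suc i)) x i" for x i
  have "trunc k (s n x) = trunc k (F x)" if n: "n \<ge> N k" for k n x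
    unfolding trunc_eq_iff
  proof (intro allI impI)
    fix i assume i: "i < k"
    define M where "M = max n (N (Suc i))"
    have "trunc (Suc i) (s M x) = trunc (Suc i) (s (N (Suc i)) x)"
      by (rule N) (simp_all add: M_def)
    moreover have "trunc k (s M x) = trunc k (s n x)"
      by (rule N) (use n in \<open>simp_all add: M_def\<close>)
    ultimately show "s n x i = F x i"
      using i by (simp add: trunc_eq_iff F_def)
  qed
  then show ?thesis by (metis that)
qed

lemma uniform_limit_continuous:
  fixes s :: "nat \<Rightarrow> cantor \<Rightarrow> cantor"
  assumes "\<And>n. continuous_on UNIV (s n)"
    and lim: "\<And>k. \<exists>N. \<forall>n\<ge>N. \<forall>x. trunc k (s n x) = trunc k (F x)"
  shows "continuous_on UNIV F"
proof (rule continuous_if_depth)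
  fix k
  obtain n where n: "\<And>x. trunc k (s n x) = trunc k (F x)" using lim by blast
  obtain m where "depth_le m (\<lambda>x. trunc k (s n x))" using continuous_depth assms(1) by blast
  then show "\<exists>m. depth_le m (\<lambda>x. trunc k (F x))" unfolding n by blast
qed

lemma uniform_limit_inverse:
  fixes s t :: "nat \<Rightarrow> cantor \<Rightarrow> cantor"
  assumes ts: "\<And>n x. t n (s n x) = x"
    and F: "\<And>k. \<exists>N. \<forall>n\<ge>N. \<forall>x. trunc k (s n x) = trunc k (F x)"
    and G: "\<And>k. \<exists>N. \<forall>n\<ge>N. \<forall>x. trunc k (t n x) = trunc k (G x)"
    and cont: "continuous_on UNIV G"
  shows "G (F x) = x"
proof (rule trunc_ext)
  fix k
  obtain m where m: "depth_le m (\<lambda>x. trunc k (G x))" using continuous_depth cont by blast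
  obtain N1 where N1: "\<And>n x. n \<ge> N1 \<Longrightarrow> trunc m (s n x) = trunc m (F x)" using F by blast
  obtain N2 where N2: "\<And>n x. n \<ge> N2 \<Longrightarrow> trunc k (t n x) = trunc k (G x)" using G by blast
  define n where "n = max N1 N2"
  have "trunc m (F x) = trunc m (s n x)" by (rule N1[symmetric]) (simp add: n_def)
  then have "trunc k (G (F x)) = trunc k (G (s n x))" by (rule depth_leD[OF m])
  also have "\<dots> = trunc k (t n (s n x))" by (rule N2[symmetric]) (simp add: n_def)
  finally show "trunc k (G (F x)) = trunc k x" by (simp only: ts)
qed

lemma Homeo2_mcomplete: "Homeo2.mcomplete"
  unfolding Homeo2.mcomplete_def
proof (intro allI impI)
  fix \<sigma> assume \<sigma>: "Homeo2.MCauchy \<sigma>"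
  then have car: "\<sigma> n \<in> carrier cantor_homeo" for n
    unfolding Homeo2.MCauchy_def by blast
  have cauchy: "\<exists>N. \<forall>n\<ge>N. \<forall>n'\<ge>N. \<forall>x. trunc k (\<sigma> n x) = trunc k (\<sigma> n' x) \<and>
      trunc k (inv_into UNIV (\<sigma> n) x) = trunc k (inv_into UNIV (\<sigma> n') x)" for k
  proof -
    have "1 / real (Suc k) > 0" by simp
    then obtain N where N: "\<And>n n'. n \<ge> N \<Longrightarrow> n' \<ge> N \<Longrightarrow> homeo_dist2 (\<sigma> n) (\<sigma> n') < 1 / real (Suc k)"
      using \<sigma> unfolding Homeo2.MCauchy_def by blast
    have "trunc k (\<sigma> n x) = trunc k (\<sigma> n' x) \<and> trunc k (inv_into UNIV (\<sigma> n) x) = trunc k (inv_into UNIV (\<sigma> n') x)"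
      if "n \<ge> N" "n' \<ge> N" for n n' x
    proof -
      have "homeo_dist (\<sigma> n) (\<sigma> n') < 1 / real (Suc k)"
          "homeo_dist (inv_into UNIV (\<sigma> n)) (inv_into UNIV (\<sigma> n')) < 1 / real (Suc k)"
        using N[OF that] unfolding homeo_dist2_def by simp_all
      then show ?thesis
        unfolding homeo_dist_less_iff using trunc_eq_mono[of "Suc k" _ _ k] by (meson lessI less_imp_le)
    qed
    then show ?thesis by blast
  qed
  obtain F where F: "\<And>k. \<exists>N. \<forall>n\<ge>N. \<forall>x. trunc k (\<sigma> n x) = trunc k (F x)"
    by (rule uniform_limit_trunc[of \<sigma>]) (use cauchy in blast)+
  obtain G where G: "\<And>k. \<exists>N. \<forall>n\<ge>N. \<forall>x. trunc k (inv_into UNIV (\<sigma> n) x) = trunc k (G x)"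
    by (rule uniform_limit_trunc[of "\<lambda>n. inv_into UNIV (\<sigma> n)"]) (use cauchy in blast)+
  have contF: "continuous_on UNIV F"
    by (rule uniform_limit_continuous[OF carrier_cantor_homeoD(1)[OF car] F])
  have contG: "continuous_on UNIV G"
    by (rule uniform_limit_continuous[OF carrier_cantor_homeoD(2)[OF car] G])
  have GF: "G (F x) = x" for x
    by (rule uniform_limit_inverse[OF carrier_cantor_homeoD(3)[OF car] F G contG])
  have FG: "F (G x) = x" for x
    by (rule uniform_limit_inverse[OF carrier_cantor_homeoD(4)[OF car] G F contF])
  have "homeomorphism UNIV UNIV F G"
    by (rule homeomorphismI) (use contF contG GF FG in auto)
  then have Fcar: "F \<in> carrier cantor_homeo" by (auto simp: cantor_homeo_def)
  have invF: "inv_into UNIV F = G" by (rule inv_unique_comp) (simp_all add: fun_eq_iff GF FG)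
  have "limitin Homeo2.mtopology \<sigma> F sequentially"
    unfolding Homeo2.limit_metric_sequentially
  proof (intro conjI allI impI Fcar)
    fix \<epsilon> :: real assume "\<epsilon> > 0"
    then obtain k where k: "1 / real (Suc k) < \<epsilon>" by (rule nat_approx_posE)
    obtain N1 where N1: "\<And>n x. n \<ge> N1 \<Longrightarrow> trunc (Suc k) (\<sigma> n x) = trunc (Suc k) (F x)"
      using F by blast
    obtain N2 where N2: "\<And>n x. n \<ge> N2 \<Longrightarrow> trunc (Suc k) (inv_into UNIV (\<sigma> n) x) = trunc (Suc k) (G x)"
      using G by blast
    have "homeo_dist2 (\<sigma> n) F < \<epsilon>" if "n \<ge> max N1 N2" for n
    proof -
      have "homeo_dist (\<sigma> n) F < 1 / real (Suc k)"
        unfolding homeo_dist_less_iff using N1 that by (meson max.boundedE)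
      moreover have "homeo_dist (inv_into UNIV (\<sigma> n)) (inv_into UNIV F) < 1 / real (Suc k)"
        unfolding homeo_dist_less_iff invF using N2 that by (meson max.boundedE)
      ultimately show ?thesis using k unfolding homeo_dist2_def by linarith
    qed
    then show "\<exists>N. \<forall>n\<ge>N. \<sigma> n \<in> carrier cantor_homeo \<and> homeo_dist2 (\<sigma> n) F < \<epsilon>"
      using car by blast
  qed
  then show "\<exists>F. limitin Homeo2.mtopology \<sigma> F sequentially" by blast
qed

lemma Homeo_completely_metrizable: "completely_metrizable_space Homeo.mtopology"
  unfolding completely_metrizable_space_def
  using Homeo2.Metric_space_axioms Homeo2_mcomplete Homeo2_mtopology by metis

text \<open>The complement of a comeager set is covered by countably many closed sets without interior;
  their complements join the given dense open sets in the Baire category theorem.\<close>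

lemma comeager_meets_dense_opens:
  fixes W :: "nat \<Rightarrow> 'a set"
  assumes X: "completely_metrizable_space X" "topspace X \<noteq> {}"
    and C: "comeager_in X C"
    and op: "\<And>n. openin X (W n)" and dense: "\<And>n. X closure_of (W n) = topspace X"
  shows "\<exists>x\<in>C. \<forall>n. x \<in> W n"
proof -
  have CX: "C \<subseteq> topspace X" and "meager_in X (topspace X - C)"
    using C unfolding comeager_in_def by simp_all
  then obtain \<N> where \<N>: "countable \<N>" "\<forall>N\<in>\<N>. nowhere_dense_in X N"
      "topspace X - C = \<Union>\<N>"
    unfolding meager_in_def by (elim exE conjE) (rule that)
  define \<G> where "\<G> = range W \<union> (\<lambda>N. topspace X - X closure_of N) ` \<N>"
  have "X closure_of \<Inter>\<G> = topspace X"
  proof (rule Baire_category)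
    show "countable \<G>" using \<N>(1) unfolding \<G>_def by simp
    fix T assume "T \<in> \<G>"
    then consider n where "T = W n" | N where "N \<in> \<N>" "T = topspace X - X closure_of N"
      unfolding \<G>_def by blast
    then show "openin X T \<and> X closure_of T = topspace X"
    proof cases
      case 1
      then show ?thesis using op dense by simp
    next
      case 2
      have "X interior_of (X closure_of N) = {}"
        using \<N>(2) 2(1) unfolding nowhere_dense_in_def by blast
      then show ?thesis
        unfolding 2(2) closure_of_complement by (simp add: openin_diff)
    qed
  qed (use X in blast)
  then have "\<Inter>\<G> \<noteq> {}" using X(2) by (metis closure_of_empty)
  then obtain x where x: "x \<in> \<Inter>\<G>" by blast
  then have xO: "x \<in> W n" for n unfolding \<G>_def by blast
  then have xX: "x \<in> topspace X" using op openin_subset by blast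
  have "x \<notin> \<Union>\<N>"
  proof
    assume "x \<in> \<Union>\<N>"
    then obtain N where N: "N \<in> \<N>" "x \<in> N" by blast
    then have "N \<subseteq> X closure_of N"
      using \<N>(2) by (intro closure_of_subset) (simp add: nowhere_dense_in_def)
    moreover have "x \<in> topspace X - X closure_of N" using x N(1) unfolding \<G>_def by blast
    ultimately show False using N(2) by blast
  qed
  then show ?thesis using xO xX \<N>(3) by blast
qed

section \<open>Homeomorphisms with two-phase structures at all scales\<close>

text \<open>The labels are allowed to be finer than prefixes. This makes the property
  invariant under conjugation, which does not carry prefixes to prefixes.\<close>

definition two_phase_at_all_scales :: "(cantor \<Rightarrow> cantor) \<Rightarrow> bool" where
  "two_phase_at_all_scales g \<longleftrightarrow> (\<forall>n. \<exists>l U J. two_phase g l U J \<and> refines l n)"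

lemma comeager_contains_two_phase:
  assumes C: "comeager_in Homeo.mtopology C"
  obtains g where "g \<in> C" "two_phase_at_all_scales g"
proof -
  define W where "W n = {g \<in> carrier cantor_homeo. \<exists>l U J. two_phase g l U J \<and> refines l n}" for n
  have "\<exists>g\<in>C. \<forall>n. g \<in> W n"
  proof (rule comeager_meets_dense_opens[OF Homeo_completely_metrizable _ C])
    show "topspace Homeo.mtopology \<noteq> {}"
      using monoid.one_closed[OF group.is_monoid[OF group_cantor_homeo]] by auto
    fix n
    show "openin Homeo.mtopology (W n)"
      unfolding Homeo.openin_mtopology
    proof (intro conjI allI impI)
      fix g assume "g \<in> W n"
      then obtain l U J where g: "two_phase g l U J" "refines l n" unfolding W_def by blast
      obtain m where m: "\<And>g'. (\<And>x. trunc m (g' x) = trunc m (g x)) \<Longrightarrow> two_phase g' l U J"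
        using two_phase_stable[OF g(1)] by blast
      have "g' \<in> W n" if "g' \<in> Homeo.mball g (1 / real (Suc m))" for g'
      proof -
        have g': "g' \<in> carrier cantor_homeo" "homeo_dist g g' < 1 / real (Suc m)"
          using that by simp_all
        have "trunc m (g' x) = trunc m (g x)" for x
          by (rule trunc_eq_mono[of "Suc m"])
            (use g'(2) in \<open>simp_all only: homeo_dist_less_iff le_add2 Suc_n_not_le_n lessI less_imp_le\<close>)
        then have "two_phase g' l U J" by (rule m)
        then show ?thesis using g'(1) g(2) unfolding W_def by blast
      qed
      then show "\<exists>r>0. Homeo.mball g r \<subseteq> W n"
        by (intro exI[of _ "1 / real (Suc m)"]) auto
    qed (auto simp: W_def)
    show "Homeo.mtopology closure_of W n = topspace Homeo.mtopology"
      unfolding Homeo.metric_closure_of Homeo.topspace_mtopology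
    proof (intro subset_antisym subsetI CollectI conjI allI impI)
      fix h and r :: real
      assume h: "h \<in> carrier cantor_homeo" and "r > 0"
      then obtain k where k: "1 / real (Suc k) < r" using nat_approx_posE by blast
      define K where "K = max n (Suc k)"
      obtain g g' U J where g: "homeomorphism UNIV UNIV g g'"
          "\<And>x. trunc K (g x) = trunc K (h x)" "two_phase g (trunc K) U J"
        using two_phase_perturbation h unfolding carrier_cantor_homeo_iff by metis
      have car: "g \<in> carrier cantor_homeo" using g(1) by (auto simp: cantor_homeo_def)
      have "trunc (Suc k) (h x) = trunc (Suc k) (g x)" for x
        by (rule trunc_eq_mono[OF g(2)[symmetric]]) (simp add: K_def)
      then have "homeo_dist h g < 1 / real (Suc k)" unfolding homeo_dist_less_iff by blast
      then have "g \<in> Homeo.mball h r" using h car k by simp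
      moreover have "refines (trunc K) n"
        unfolding refines_def K_def by (blast intro: trunc_eq_mono max.cobounded1)
      then have "g \<in> W n" using car g(3) unfolding W_def by blast
      ultimately show "\<exists>y\<in>W n. y \<in> Homeo.mball h r" by blast
    qed auto
  qed
  then obtain g where "g \<in> C" "\<And>n. g \<in> W n" by blast
  then show ?thesis using that unfolding two_phase_at_all_scales_def W_def by blast
qed

lemma (in two_phase) conjugate:
  assumes k: "homeomorphism UNIV UNIV k k'"
  shows "two_phase (k \<circ> g \<circ> k') (l \<circ> k') (k' -` U) (k' -` J)"
proof
  have k'k: "k' (k x) = x" "k (k' x) = x" for x using k by (simp_all add: homeomorphism_def)
  obtain m where m: "depth_le m (\<lambda>x. (l x, x \<in> U, x \<in> J))" using finite_depth by blast
  obtain m' where m': "depth_le m' (\<lambda>x. trunc m (k' x))"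
    using continuous_depth homeomorphism_cont2[OF k] by blast
  have "depth_le m' (\<lambda>x. (l (k' x), k' x \<in> U, k' x \<in> J))"
    unfolding depth_le_def
  proof (intro allI impI)
    fix x y assume "trunc m' x = trunc m' y"
    then show "(l (k' x), k' x \<in> U, k' x \<in> J) = (l (k' y), k' y \<in> U, k' y \<in> J)"
      by (intro depth_leD[OF m] depth_leD[OF m'])
  qed
  then show "\<exists>m. depth_le m (\<lambda>x. ((l \<circ> k') x, x \<in> k' -` U, x \<in> k' -` J))"
    by auto
  show "(k \<circ> g \<circ> k') x \<in> k' -` J \<longleftrightarrow> x \<in> k' -` J" for x
    by (simp add: k'k invariant)
  show "x \<in> k' -` U" if "(k \<circ> g \<circ> k') x \<in> k' -` U" for x
    using that backward_closed by (simp add: k'k)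
  show "(l \<circ> k') ((k \<circ> g \<circ> k') x) = (l \<circ> k') ((k \<circ> g \<circ> k') y)"
    if "x \<notin> k' -` U" "y \<notin> k' -` U" "(l \<circ> k') x = (l \<circ> k') y" for x y
    using that forward_det[of "k' x" "k' y"] by (simp add: k'k)
  show "(l \<circ> k') x = (l \<circ> k') y"
    if "(k \<circ> g \<circ> k') x \<in> k' -` U" "(k \<circ> g \<circ> k') y \<in> k' -` U"
      "(l \<circ> k') ((k \<circ> g \<circ> k') x) = (l \<circ> k') ((k \<circ> g \<circ> k') y)" for x y
    using that backward_det[of "k' x" "k' y"] by (simp add: k'k)
  show "\<exists>y. (l \<circ> k') y = (l \<circ> k') x \<and>
      (l \<circ> k') ((k \<circ> g \<circ> k') y) = (l \<circ> k') ((k \<circ> g \<circ> k') x) \<and>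
      y \<in> k' -` U \<and> (k \<circ> g \<circ> k') y \<notin> k' -` U \<and> (y \<in> k' -` J \<longleftrightarrow> i)" for x i
  proof -
    obtain y where "l y = l (k' x)" "l (g y) = l (g (k' x))" "y \<in> U" "g y \<notin> U" "y \<in> J \<longleftrightarrow> i"
      using crossing by blast
    then show ?thesis by (intro exI[of _ "k y"]) (simp add: k'k)
  qed
qed

lemma two_phase_at_all_scales_conjugate:
  assumes g: "two_phase_at_all_scales g" and k: "homeomorphism UNIV UNIV k k'"
  shows "two_phase_at_all_scales (k \<circ> g \<circ> k')"
  unfolding two_phase_at_all_scales_def
proof
  fix n
  obtain m where m: "depth_le m (\<lambda>x. trunc n (k x))"
    using continuous_depth homeomorphism_cont1[OF k] by blast
  obtain l U J where l: "two_phase g l U J" "refines l m" using g unfolding two_phase_at_all_scales_def by blast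
  have "refines (l \<circ> k') n"
    unfolding refines_def
  proof (intro allI impI)
    fix x y assume "(l \<circ> k') x = (l \<circ> k') y"
    then have "trunc m (k' x) = trunc m (k' y)" by (intro refinesD[OF l(2)]) simp
    then have "trunc n (k (k' x)) = trunc n (k (k' y))" by (rule depth_leD[OF m])
    then show "trunc n x = trunc n y" using k by (simp add: homeomorphism_def)
  qed
  then show "\<exists>l U J. two_phase (k \<circ> g \<circ> k') l U J \<and> refines l n"
    using two_phase.conjugate[OF l(1) k] by blast
qed

text \<open>A comeager class contains one homeomorphism with the property, and each of its elements is
  conjugate to that one.\<close>

lemma comeager_conjugacy_class_two_phase:
  assumes C: "comeager_conjugacy_class C" and h: "h \<in> C"
  shows "h \<in> carrier cantor_homeo" "two_phase_at_all_scales h"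
proof -
  interpret G: group cantor_homeo by (rule group_cantor_homeo)
  obtain f where f: "f \<in> carrier cantor_homeo" "C = conjugacy_class cantor_homeo f"
      "comeager_in Homeo.mtopology C"
    using C unfolding comeager_conjugacy_class_def by blast
  obtain g where g: "g \<in> C" "two_phase_at_all_scales g" using comeager_contains_two_phase[OF f(3)] by blast
  have cl: "\<exists>a\<in>carrier cantor_homeo. p = a \<otimes>\<^bsub>cantor_homeo\<^esub> f \<otimes>\<^bsub>cantor_homeo\<^esub> inv\<^bsub>cantor_homeo\<^esub> a"
    if "p \<in> C" for p
    using that unfolding f(2) conjugacy_class_def by blast
  obtain a b where a: "a \<in> carrier cantor_homeo"
      "g = a \<otimes>\<^bsub>cantor_homeo\<^esub> f \<otimes>\<^bsub>cantor_homeo\<^esub> inv\<^bsub>cantor_homeo\<^esub> a"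
    and b: "b \<in> carrier cantor_homeo"
      "h = b \<otimes>\<^bsub>cantor_homeo\<^esub> f \<otimes>\<^bsub>cantor_homeo\<^esub> inv\<^bsub>cantor_homeo\<^esub> b"
    using cl[OF g(1)] cl[OF h] by blast
  show "h \<in> carrier cantor_homeo" using b f(1) by simp
  have inv: "inv\<^bsub>cantor_homeo\<^esub> p = inv_into UNIV p" if "p \<in> carrier cantor_homeo" for p
    using inv_cantor_homeo[OF that] .
  \<comment> \<open>\<open>g\<close> and \<open>h\<close> are the conjugates of \<open>f\<close> by \<open>a\<close> and \<open>b\<close>.\<close>
  define k where "k = b \<circ> inv_into UNIV a"
  have k: "homeomorphism UNIV UNIV k (a \<circ> inv_into UNIV b)"
    unfolding k_def using a(1) b(1) homeomorphism_compose homeomorphism_symD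
    unfolding carrier_cantor_homeo_iff by metis
  have "h = k \<circ> g \<circ> (a \<circ> inv_into UNIV b)"
    unfolding a(2) b(2) inv[OF a(1)] inv[OF b(1)] k_def
    by (simp add: cantor_homeo_def fun_eq_iff carrier_cantor_homeoD(3)[OF a(1)])
  then show "two_phase_at_all_scales h" using two_phase_at_all_scales_conjugate[OF g(2) k] by simp
qed

section \<open>Recurrence and chain continuity in terms of prefixes\<close>

lemma continuous_funpow:
  fixes h :: "'a::topological_space \<Rightarrow> 'a"
  assumes "continuous_on UNIV h"
  shows "continuous_on UNIV (h ^^ n)"
proof (induction n)
  case (Suc n)
  have "continuous_on UNIV (h \<circ> h ^^ n)"
    by (rule continuous_on_compose[OF Suc continuous_on_subset[OF assms subset_UNIV]])
  then show ?case by (simp only: funpow.simps)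
qed (simp add: id_def)

text \<open>Over a fixed number of steps the errors of a chain stay under control by uniform
  continuity alone.\<close>

lemma chain_tracks_orbit:
  assumes h: "continuous_on UNIV (h :: cantor \<Rightarrow> cantor)"
  shows "\<exists>m\<ge>K. \<forall>y. trunc m (y 0) = trunc m x \<and> (\<forall>n. trunc m (y (Suc n)) = trunc m (h (y n)))
    \<longrightarrow> trunc K (y t) = trunc K ((h ^^ t) x)"
proof (induction t arbitrary: K)
  case 0
  then show ?case by (intro exI[of _ K]) simp
next
  case (Suc t)
  obtain k where k: "depth_le k (\<lambda>x. trunc K (h x))" using continuous_depth h by blast
  obtain m where m: "m \<ge> k" "\<And>y. trunc m (y 0) = trunc m x \<Longrightarrow>
      (\<And>n. trunc m (y (Suc n)) = trunc m (h (y n))) \<Longrightarrow> trunc k (y t) = trunc k ((h ^^ t) x)"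
    using Suc[of k] by blast
  show ?case
  proof (intro exI[of _ "max m K"] conjI allI impI)
    fix y assume y: "trunc (max m K) (y 0) = trunc (max m K) x \<and>
      (\<forall>n. trunc (max m K) (y (Suc n)) = trunc (max m K) (h (y n)))"
    have "trunc k (y t) = trunc k ((h ^^ t) x)"
      using y by (intro m(2)) (blast intro: trunc_eq_mono max.cobounded1)+
    then have "trunc K (h (y t)) = trunc K (h ((h ^^ t) x))" by (rule depth_leD[OF k])
    moreover have "trunc K (y (Suc t)) = trunc K (h (y t))"
      using y by (blast intro: trunc_eq_mono max.cobounded2)
    ultimately show "trunc K (y (Suc t)) = trunc K ((h ^^ Suc t) x)" by simp
  qed simp
qed

lemma returns_if_recurrent:
  assumes "Cantor.recurrent h x"
  shows "\<exists>n>0. trunc k ((h ^^ n) x) = trunc k x"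
proof -
  obtain r :: "nat \<Rightarrow> nat" where
    "limitin Cantor.mtopology ((\<lambda>n. (h ^^ Suc n) x) \<circ> r) x sequentially"
    using assms unfolding Cantor.recurrent_def by blast
  moreover have "1 / real (Suc k) > 0" by simp
  ultimately obtain N where "cantor_dist ((h ^^ Suc (r N)) x) x < 1 / real (Suc k)"
    unfolding Cantor.limit_metric_sequentially comp_def by blast
  then have "trunc (Suc k) ((h ^^ Suc (r N)) x) = trunc (Suc k) x"
    unfolding cantor_dist_less_iff_trunc .
  then have "trunc k ((h ^^ Suc (r N)) x) = trunc k x" by (rule trunc_eq_mono) simp
  then show ?thesis by blast
qed

text \<open>A point that comes back to each of its neighbourhoods does so at arbitrarily late times:
  either it is periodic, or the finitely many early times can be excluded by a smaller
  neighbourhood. The late returns yield the subsequence.\<close>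

lemma recurrent_if_returns:
  assumes ret: "\<And>k. \<exists>n>0. trunc k ((h ^^ n) x) = trunc k x"
  shows "Cantor.recurrent h x"
proof -
  have late: "\<exists>n>N. trunc k ((h ^^ n) x) = trunc k x" for k N
  proof (cases "\<exists>p>0. (h ^^ p) x = x")
    case True
    then obtain p where p: "p > 0" "(h ^^ p) x = x" by blast
    have "((h ^^ p) ^^ j) x = x" for j by (induction j) (simp_all add: p(2))
    then have "(h ^^ (p * Suc N)) x = x" by (simp only: funpow_mult)
    moreover have "p * Suc N > N" using p(1) by (cases p) auto
    ultimately show ?thesis by metis
  next
    case False
    have "\<exists>K\<ge>k. \<forall>i. 0 < i \<and> i \<le> N \<longrightarrow> trunc K ((h ^^ i) x) \<noteq> trunc K x"
    proof (induction N)
      case (Suc N)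
      then obtain K where K: "K \<ge> k" "\<And>i. 0 < i \<Longrightarrow> i \<le> N \<Longrightarrow> trunc K ((h ^^ i) x) \<noteq> trunc K x"
        by blast
      obtain K' where K': "trunc K' ((h ^^ Suc N) x) \<noteq> trunc K' x"
        using False trunc_ext zero_less_Suc by metis
      show ?case
      proof (intro exI[of _ "max K K'"] conjI allI impI)
        show "trunc (max K K') ((h ^^ i) x) \<noteq> trunc (max K K') x" if "0 < i \<and> i \<le> Suc N" for i
        proof (cases "i = Suc N")
          case True
          then show ?thesis using K' trunc_eq_mono max.cobounded2 by metis
        next
          case False
          then have "i \<le> N" using that by simp
          then show ?thesis using K(2)[of i] that trunc_eq_mono max.cobounded1 by metis
        qed
      qed (use K(1) in simp)
    qed auto
    then obtain K where K: "K \<ge> k" "\<And>i. 0 < i \<Longrightarrow> i \<le> N \<Longrightarrow> trunc K ((h ^^ i) x) \<noteq> trunc K x"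
      by blast
    obtain n where n: "n > 0" "trunc K ((h ^^ n) x) = trunc K x" using ret by blast
    then have "n > N" using K(2) not_less by blast
    then show ?thesis using trunc_eq_mono[OF n(2) K(1)] by blast
  qed
  have "\<exists>r. \<forall>n. trunc (Suc n) ((h ^^ Suc (r n)) x) = trunc (Suc n) x \<and> r n < r (Suc n)"
  proof (rule dependent_nat_choice)
    show "\<exists>r. trunc (Suc 0) ((h ^^ Suc r) x) = trunc (Suc 0) x"
      using late[of 0 "Suc 0"] by (metis Suc_pred)
    show "\<exists>r'. trunc (Suc (Suc n)) ((h ^^ Suc r') x) = trunc (Suc (Suc n)) x \<and> r < r'" for r n
      using late[of "Suc r" "Suc (Suc n)"] by (metis Suc_less_eq2)
  qed
  then obtain r where r: "\<And>n. trunc (Suc n) ((h ^^ Suc (r n)) x) = trunc (Suc n) x"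
      "\<And>n. r n < r (Suc n)" by blast
  have "limitin Cantor.mtopology ((\<lambda>n. (h ^^ Suc n) x) \<circ> r) x sequentially"
    unfolding Cantor.limit_metric_sequentially comp_def
  proof (intro conjI allI impI UNIV_I)
    fix \<epsilon> :: real assume "\<epsilon> > 0"
    then obtain k where k: "1 / real (Suc k) < \<epsilon>" by (rule nat_approx_posE)
    have "cantor_dist ((h ^^ Suc (r n)) x) x < \<epsilon>" if "n \<ge> k" for n
    proof -
      have "trunc (Suc k) ((h ^^ Suc (r n)) x) = trunc (Suc k) x"
        by (rule trunc_eq_mono[OF r(1)]) (use that in simp)
      then have "cantor_dist ((h ^^ Suc (r n)) x) x < 1 / real (Suc k)"
        unfolding cantor_dist_less_iff_trunc .
      then show ?thesis using k by linarith
    qed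
    then show "\<exists>N. \<forall>n\<ge>N. (h ^^ Suc (r n)) x \<in> UNIV \<and> cantor_dist ((h ^^ Suc (r n)) x) x < \<epsilon>"
      by blast
  qed
  moreover have "strict_mono r" using r(2) by (simp add: strict_mono_Suc_iff)
  ultimately show ?thesis unfolding Cantor.recurrent_def by blast
qed

lemma chain_continuous_if_trunc:
  assumes "\<And>k. \<exists>m. \<forall>y. trunc m (y 0) = trunc m x \<and> (\<forall>n. trunc m (y (Suc n)) = trunc m (h (y n)))
    \<longrightarrow> (\<forall>n. trunc k (y n) = trunc k ((h ^^ n) x))"
  shows "Cantor.chain_continuous_at h x"
  unfolding Cantor.chain_continuous_at_def
proof (intro allI impI)
  fix \<epsilon> :: real assume "\<epsilon> > 0"
  then obtain k where k: "1 / real (Suc k) < \<epsilon>" by (rule nat_approx_posE)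
  obtain m where m: "\<forall>y. trunc m (y 0) = trunc m x \<and>
      (\<forall>n. trunc m (y (Suc n)) = trunc m (h (y n))) \<longrightarrow>
      (\<forall>n. trunc (Suc k) (y n) = trunc (Suc k) ((h ^^ n) x))"
    using assms[of "Suc k"] by (elim exE) (rule that)
  have ball: "trunc m b = trunc m a" if "b \<in> Cantor.mball a (1 / real (Suc m))" for a b
  proof -
    have "trunc (Suc m) b = trunc (Suc m) a"
      using that unfolding Cantor.in_mball cantor_dist_less_iff_trunc by simp
    then show ?thesis by (rule trunc_eq_mono) simp
  qed
  show "\<exists>\<delta>>0. \<forall>y. y 0 \<in> Cantor.mball x \<delta> \<and> (\<forall>n. y (Suc n) \<in> Cantor.mball (h (y n)) \<delta>) \<longrightarrow>
      (\<forall>n. cantor_dist (y n) ((h ^^ n) x) < \<epsilon>)"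
  proof (intro exI[of _ "1 / real (Suc m)"] conjI allI impI)
    fix y n
    assume y: "y 0 \<in> Cantor.mball x (1 / real (Suc m)) \<and>
      (\<forall>n. y (Suc n) \<in> Cantor.mball (h (y n)) (1 / real (Suc m)))"
    have "trunc (Suc k) (y n) = trunc (Suc k) ((h ^^ n) x)"
      using m y ball by blast
    then have "cantor_dist (y n) ((h ^^ n) x) < 1 / real (Suc k)"
      unfolding cantor_dist_less_iff_trunc .
    then show "cantor_dist (y n) ((h ^^ n) x) < \<epsilon>" using k by linarith
  qed simp
qed

section \<open>Orbits and chains under a two-phase structure\<close>

context two_phase
begin

lemma depthE:
  obtains m where "\<And>x y. trunc m x = trunc m y \<Longrightarrow> l x = l y"
    "\<And>x y. trunc m x = trunc m y \<Longrightarrow> x \<in> U \<longleftrightarrow> y \<in> U"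
    "\<And>x y. trunc m x = trunc m y \<Longrightarrow> x \<in> J \<longleftrightarrow> y \<in> J"
proof -
  obtain m where "depth_le m (\<lambda>x. (l x, x \<in> U, x \<in> J))" using finite_depth by blast
  from depth_leD[OF this] show ?thesis by (intro that[of m]) blast+
qed

lemma depth_U: "\<exists>m. depth_le m (\<lambda>x. x \<in> U)"
  unfolding depth_le_def by (rule depthE) blast

lemma depth_J: "\<exists>m. depth_le m (\<lambda>x. x \<in> J)"
  unfolding depth_le_def by (rule depthE) blast

lemma finite_labels: "finite (range l)"
proof -
  obtain m where m: "\<And>x y. trunc m x = trunc m y \<Longrightarrow> l x = l y" by (rule depthE) blast
  have "range l \<subseteq> l ` range (trunc m)"
  proof (rule image_subsetI)
    fix x have "l x = l (trunc m x)" by (rule m) simp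
    then show "l x \<in> l ` range (trunc m)" by simp
  qed
  then show ?thesis using finite_range_trunc finite_subset by blast
qed

lemma stays_outside: "(g ^^ t) x \<notin> U \<Longrightarrow> t \<le> n \<Longrightarrow> (g ^^ n) x \<notin> U"
proof (induction n)
  case (Suc n)
  then show ?case using backward_closed by (cases "t = Suc n") auto
qed simp

text \<open>There are finitely many labels, so two times have equal labels, and the rule for
  preimages moves this coincidence back to time \<open>0\<close>.\<close>

lemma label_recurs_or_leaves:
  assumes "\<And>j. (g ^^ j) x \<in> U"
  shows "\<exists>n>0. l ((g ^^ n) x) = l x"
proof -
  have backwards: "l ((g ^^ i) x) = l ((g ^^ (i + d)) x) \<Longrightarrow> l x = l ((g ^^ d) x)" for i d
  proof (induction i)
    case (Suc i)
    then have "l (g ((g ^^ i) x)) = l (g ((g ^^ (i + d)) x))" by simp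
    moreover have "g ((g ^^ i) x) \<in> U" "g ((g ^^ (i + d)) x) \<in> U"
      using assms[of "Suc i"] assms[of "Suc (i + d)"] by simp_all
    ultimately show ?case using backward_det Suc.IH by blast
  qed simp
  have "\<not> inj (\<lambda>j. l ((g ^^ j) x))"
  proof
    assume "inj (\<lambda>j. l ((g ^^ j) x))"
    then have "infinite (range (\<lambda>j. l ((g ^^ j) x)))" by (rule range_inj_infinite)
    then show False using finite_labels by (metis (no_types, lifting) finite_subset image_subsetI rangeI)
  qed
  then obtain i j where ij: "l ((g ^^ i) x) = l ((g ^^ j) x)" "i < j"
    unfolding inj_def by (metis linorder_neqE_nat)
  then show ?thesis
    using backwards[of i "j - i"] by (intro exI[of _ "j - i"]) simp
qed

text \<open>Errors of a chain do not accumulate here: an error that is too small to change a label is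
  forgotten at the next step, since the label alone determines the next one.\<close>

lemma chain_follows_labels:
  assumes depth: "\<And>x y. trunc m x = trunc m y \<Longrightarrow> l x = l y"
      "\<And>x y. trunc m x = trunc m y \<Longrightarrow> x \<in> U \<longleftrightarrow> y \<in> U"
    and chain: "\<And>n. trunc m (y (Suc n)) = trunc m (g (y n))"
    and start: "(g ^^ t) x \<notin> U" "trunc m (y t) = trunc m ((g ^^ t) x)"
    and "t \<le> n"
  shows "y n \<notin> U \<and> l (y n) = l ((g ^^ n) x)"
  using \<open>t \<le> n\<close>
proof (induction n rule: dec_induct)
  case base
  then show ?case using depth start by blast
next
  case (step n)
  have "l (g (y n)) = l (g ((g ^^ n) x))"
    using forward_det step.IH stays_outside[OF start(1) step.hyps(1)] by blast
  moreover have "g (y n) \<notin> U" using step.IH backward_closed by blast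
  ultimately show ?case using depth[OF chain[of n]] by simp
qed

text \<open>The complement of \<open>U\<close> is forward invariant, so the orbit never comes back to the clopen set
  \<open>U\<close>.\<close>

lemma leaving_not_recurrent:
  assumes "x \<in> U" "g x \<notin> U"
  shows "\<not> Cantor.recurrent g x"
proof
  assume "Cantor.recurrent g x"
  obtain m where m: "\<And>x y. trunc m x = trunc m y \<Longrightarrow> x \<in> U \<longleftrightarrow> y \<in> U" by (rule depthE) blast
  obtain n where n: "n > 0" "trunc m ((g ^^ n) x) = trunc m x"
    using returns_if_recurrent[OF \<open>Cantor.recurrent g x\<close>] by blast
  have "(g ^^ n) x \<notin> U" by (rule stays_outside[of 1]) (use assms n in simp_all)
  then show False using m[OF n(2)] assms(1) by blast
qed

end

text \<open>The structure is taken finer than both the required accuracy \<open>k\<close> and the neighbourhood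
  of \<open>x\<close> to which its orbit does not return; the latter forces the orbit out of \<open>U\<close>.\<close>

lemma nonrecurrent_chain_continuous:
  assumes cont: "continuous_on UNIV h" and gen: "two_phase_at_all_scales h"
    and nr: "\<not> Cantor.recurrent h x"
  shows "Cantor.chain_continuous_at h x"
proof (rule chain_continuous_if_trunc)
  fix k
  obtain k0 where k0: "\<And>n. n > 0 \<Longrightarrow> trunc k0 ((h ^^ n) x) \<noteq> trunc k0 x"
    using recurrent_if_returns nr by blast
  obtain l U J where tp: "two_phase h l U J" and ref: "refines l (max k k0)"
    using gen unfolding two_phase_at_all_scales_def by blast
  interpret two_phase h l U J by fact
  have ref_k: "trunc k a = trunc k b" and ref_k0: "trunc k0 a = trunc k0 b" if "l a = l b" for a b
    by (rule trunc_eq_mono[OF refinesD[OF ref that]], simp)+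
  obtain t where t: "(h ^^ t) x \<notin> U"
    using label_recurs_or_leaves[of x] k0 ref_k0 by blast
  obtain d where d: "\<And>x y. trunc d x = trunc d y \<Longrightarrow> l x = l y"
      "\<And>x y. trunc d x = trunc d y \<Longrightarrow> x \<in> U \<longleftrightarrow> y \<in> U" by (rule depthE) blast
  define K where "K = max k d"
  have "\<exists>m\<ge>K. \<forall>y. trunc m (y 0) = trunc m x \<and> (\<forall>n. trunc m (y (Suc n)) = trunc m (h (y n)))
      \<longrightarrow> (\<forall>i\<le>t. trunc K (y i) = trunc K ((h ^^ i) x))"
  proof -
    obtain m where m: "\<And>i. m i \<ge> K" "\<And>i y. trunc (m i) (y 0) = trunc (m i) x \<Longrightarrow>
        (\<forall>n. trunc (m i) (y (Suc n)) = trunc (m i) (h (y n))) \<Longrightarrow> trunc K (y i) = trunc K ((h ^^ i) x)"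
      using chain_tracks_orbit[OF cont, of K x] by metis
    define M where "M = Max (m ` {..t})"
    have M: "m i \<le> M" if "i \<le> t" for i unfolding M_def using that by simp
    show ?thesis
    proof (intro exI[of _ M] conjI allI impI)
      show "K \<le> M" using m(1)[of 0] M[of 0] by simp
      fix y i assume y: "trunc M (y 0) = trunc M x \<and> (\<forall>n. trunc M (y (Suc n)) = trunc M (h (y n)))"
        and i: "i \<le> t"
      show "trunc K (y i) = trunc K ((h ^^ i) x)"
        using y M[OF i] by (intro m(2)[of i]) (blast intro: trunc_eq_mono)+
    qed
  qed
  then obtain m where m: "m \<ge> K" "\<And>y i. trunc m (y 0) = trunc m x \<Longrightarrow>
      (\<And>n. trunc m (y (Suc n)) = trunc m (h (y n))) \<Longrightarrow> i \<le> t \<Longrightarrow>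
      trunc K (y i) = trunc K ((h ^^ i) x)" by blast
  show "\<exists>m. \<forall>y. trunc m (y 0) = trunc m x \<and> (\<forall>n. trunc m (y (Suc n)) = trunc m (h (y n)))
      \<longrightarrow> (\<forall>n. trunc k (y n) = trunc k ((h ^^ n) x))"
  proof (intro exI[of _ m] allI impI)
    fix y n
    assume y: "trunc m (y 0) = trunc m x \<and> (\<forall>n. trunc m (y (Suc n)) = trunc m (h (y n)))"
    then have early: "trunc K (y i) = trunc K ((h ^^ i) x)" if "i \<le> t" for i
      using m(2) that by blast
    show "trunc k (y n) = trunc k ((h ^^ n) x)"
    proof (cases "n \<le> t")
      case True
      from early[OF this] show ?thesis by (rule trunc_eq_mono) (simp add: K_def)
    next
      case False
      have "y n \<notin> U \<and> l (y n) = l ((h ^^ n) x)"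
      proof (rule chain_follows_labels[OF d])
        have "d \<le> m" using m(1) by (simp add: K_def)
        then show "trunc d (y (Suc n)) = trunc d (h (y n))" for n
          using y trunc_eq_mono by blast
        show "trunc d (y t) = trunc d ((h ^^ t) x)"
          by (rule trunc_eq_mono[OF early]) (simp_all add: K_def)
      qed (use t False in simp_all)
      then show ?thesis using ref_k by blast
    qed
  qed
qed

text \<open>The open set consists of the points that cross from \<open>U\<close> to its complement for some
  structure. It is dense because each piece of each structure contains a crossing point, and
  structures exist at all scales.\<close>

lemma nonrecurrent_dense_open:
  assumes cont: "continuous_on UNIV h" and gen: "two_phase_at_all_scales h"
  shows "\<exists>W. open W \<and> closure W = UNIV \<and> (\<forall>x\<in>W. \<not> Cantor.recurrent h x)"
proof (intro exI conjI)
  define W where "W = \<Union>{{x\<in>U. h x \<notin> U} | l U J. two_phase h l U J}"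
  show "open W"
    unfolding W_def
  proof (rule open_Union, clarify)
    fix l U J assume "two_phase h l U J"
    then obtain m where m: "depth_le m (\<lambda>x. x \<in> U)" using two_phase.depth_U by blast
    have "open U" "open (- U)"
      using depth_le_open[OF m, of "\<lambda>c. c"] depth_le_open[OF m, of "\<lambda>c. \<not> c"]
      by (simp_all add: Compl_eq)
    then have "open (U \<inter> h -` (- U))"
      using cont by (metis continuous_on_open_vimage inf_top_right open_UNIV open_Int)
    moreover have "U \<inter> h -` (- U) = {x\<in>U. h x \<notin> U}" by blast
    ultimately show "open {x\<in>U. h x \<notin> U}" by simp
  qed
  show "\<forall>x\<in>W. \<not> Cantor.recurrent h x"
    unfolding W_def using two_phase.leaving_not_recurrent by blast
  have "W \<inter> S \<noteq> {}" if S: "open S" "S \<noteq> {}" for S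
  proof -
    obtain x where x: "x \<in> S" using S(2) by blast
    obtain n where n: "\<And>y. trunc n y = trunc n x \<Longrightarrow> y \<in> S"
      using open_contains_cylinder[OF S(1) x] by blast
    obtain l U J where l: "two_phase h l U J" "refines l n"
      using gen unfolding two_phase_at_all_scales_def by blast
    obtain y where y: "l y = l x" "y \<in> U" "h y \<notin> U"
      using two_phase.crossing[OF l(1), of x] by blast
    then have "y \<in> S" using n refinesD[OF l(2)] by blast
    moreover have "y \<in> W" unfolding W_def using l(1) y(2,3) by blast
    ultimately show ?thesis by blast
  qed
  then show "closure W = UNIV"
    using open_Compl[OF closed_closure[of W]] closure_subset[of W] by blast
qed

section \<open>Points at which equicontinuity fails\<close>

context two_phase
begin

definition leaves :: "cantor set" where
  "leaves = {x. \<exists>j. (g ^^ j) x \<notin> U}"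

text \<open>A point of \<open>U\<close> and a point outside \<open>U\<close> differ in one of the boundedly many
  coordinates that \<open>U\<close> depends on. Their distance is thus bounded below, and the orbits of \<open>x\<close> and of
  suitable points arbitrarily close to \<open>x\<close> are at some time separated in this way.\<close>

lemma frontier_not_equicontinuous:
  assumes x: "x \<in> closure leaves" "x \<notin> leaves"
  shows "\<not> Cantor.equicontinuous_at g x"
proof
  assume eq: "Cantor.equicontinuous_at g x"
  obtain m where m: "\<And>x y. trunc m x = trunc m y \<Longrightarrow> x \<in> U \<longleftrightarrow> y \<in> U" by (rule depthE) blast
  have "1 / real (Suc m) > 0" by simp
  then obtain \<delta> where \<delta>: "\<delta> > 0"
      "\<And>y n. cantor_dist y x < \<delta> \<Longrightarrow> cantor_dist ((g ^^ n) y) ((g ^^ n) x) < 1 / real (Suc m)"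
    using eq unfolding Cantor.equicontinuous_at_def by (meson UNIV_I)
  obtain k where k: "1 / real (Suc k) < \<delta>" using \<delta>(1) by (rule nat_approx_posE)
  have "{y. trunc (Suc k) y = trunc (Suc k) x} \<inter> leaves \<noteq> {}"
    using open_Int_closure_eq_empty[OF open_trunc_cylinder[of "Suc k" x], of leaves] x(1)
    by blast
  then obtain y where y: "trunc (Suc k) y = trunc (Suc k) x" "y \<in> leaves" by blast
  obtain j where j: "(g ^^ j) y \<notin> U" using y(2) unfolding leaves_def by blast
  have "cantor_dist y x < 1 / real (Suc k)"
    using y(1) unfolding cantor_dist_less_iff_trunc .
  then have "cantor_dist ((g ^^ j) y) ((g ^^ j) x) < 1 / real (Suc m)"
    using k by (intro \<delta>(2)) linarith
  then have "trunc (Suc m) ((g ^^ j) y) = trunc (Suc m) ((g ^^ j) x)"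
    unfolding cantor_dist_less_iff_trunc .
  then have "trunc m ((g ^^ j) y) = trunc m ((g ^^ j) x)" by (rule trunc_eq_mono) simp
  moreover have "(g ^^ j) x \<in> U" using x(2) unfolding leaves_def by blast
  ultimately show False using m j by blast
qed

text \<open>A point that crosses within \<open>I n\<close>, pulled back \<open>n\<close> times, stays in \<open>U\<close> for
  \<open>n\<close> steps and then leaves. Hence the closed sets of points in \<open>I n\<close> that are limits of leaving points
  and stay in \<open>U\<close> for \<open>n\<close> steps are nonempty, and they decrease with \<open>n\<close>.\<close>

lemma frontier_meets_nested:
  assumes g: "continuous_on UNIV g" "surj g"
    and I: "\<And>n. closed (I n)" "decseq I" "\<And>n x. g x \<in> I n \<longleftrightarrow> x \<in> I n"
    and cross: "\<And>n. \<exists>x\<in>I n \<inter> U. g x \<notin> U"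
  shows "\<exists>z\<in>closure leaves - leaves. \<forall>n. z \<in> I n"
proof -
  define T where "T n = I n \<inter> ((g ^^ n) -` U \<inter> closure leaves)" for n
  obtain m where m: "depth_le m (\<lambda>x. x \<in> U)" using depth_U by blast
  have "closed U" using depth_le_closed[OF m, of "\<lambda>c. c"] by simp
  then have "closed ((g ^^ n) -` U)" for n
    using continuous_closed_vimage continuous_funpow[OF g(1)]
    by (metis continuous_on_closed_vimage closed_UNIV inf_top_right)
  then have closed: "closed (T n)" for n
    unfolding T_def using I(1) by (intro closed_Int closed_closure)
  have nonempty: "T n \<noteq> {}" for n
  proof -
    obtain x where x: "x \<in> I n" "x \<in> U" "g x \<notin> U" using cross by blast
    obtain y where y: "(g ^^ n) y = x" using surj_fn[OF g(2)] by (metis surjD)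
    have "(g ^^ j) y \<in> I n \<longleftrightarrow> y \<in> I n" for j by (induction j) (simp_all add: I(3))
    then have "y \<in> I n" using x(1) y by metis
    moreover have "(g ^^ Suc n) y \<notin> U" using x(3) y by simp
    then have "y \<in> leaves" unfolding leaves_def by (intro CollectI exI)
    then have "y \<in> closure leaves" by (rule subsetD[OF closure_subset])
    ultimately show ?thesis using x(2) y unfolding T_def by blast
  qed
  have "T (Suc n) \<subseteq> T n" for n
    using decseq_SucD[OF I(2), of n] backward_closed unfolding T_def by auto
  then have dec: "decseq T" by (rule decseq_SucI)
  have "UNIV \<inter> (\<Inter>n. T n) \<noteq> {}"
  proof (rule compact_imp_fip_image[OF compact_UNIV_cantor closed])
    fix N :: "nat set" assume "finite N"
    then have "T (Max (insert 0 N)) \<subseteq> (\<Inter>n\<in>N. T n)"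
      by (intro INT_greatest decseqD[OF dec]) simp
    then show "UNIV \<inter> (\<Inter>n\<in>N. T n) \<noteq> {}" using nonempty by blast
  qed
  then obtain z where z: "\<And>n. z \<in> T n" by blast
  then have "z \<in> closure leaves - leaves" unfolding T_def leaves_def by blast
  then show ?thesis using z unfolding T_def by blast
qed

end

lemma uncountable_cantor: "uncountable (UNIV :: cantor set)"
proof
  assume "countable (UNIV :: cantor set)"
  then obtain f :: "nat \<Rightarrow> cantor" where f: "range f = UNIV"
    using uncountable_def by blast
  then obtain n where "f n = (\<lambda>i. \<not> f i i)" by (metis rangeE UNIV_I)
  then show False by (metis (full_types))
qed

text \<open>The sets to be split are the clopen invariant sets on which crossing from \<open>U\<close> occurs. A
  structure with labels that refine such a set \<open>I\<close> and \<open>U\<close> has the transition of some crossing point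
  of \<open>I\<close> also inside and outside its own invariant set \<open>K\<close>, so both parts
  of \<open>I\<close> are of the same kind. Different branches of the resulting tree lead to disjoint sets.\<close>

lemma uncountable_not_equicontinuous:
  assumes h: "h \<in> carrier cantor_homeo" and gen: "two_phase_at_all_scales h"
  shows "\<exists>S. uncountable S \<and> (\<forall>x\<in>S. \<not> Cantor.equicontinuous_at h x)"
proof -
  obtain l U J where "two_phase h l U J" using gen unfolding two_phase_at_all_scales_def by blast
  interpret two_phase h l U J by fact
  obtain d0 where d0: "depth_le d0 (\<lambda>x. x \<in> U)" using depth_U by blast
  define good where "good I \<longleftrightarrow> (\<exists>d. depth_le d (\<lambda>x. x \<in> I)) \<and>
    (\<forall>x. h x \<in> I \<longleftrightarrow> x \<in> I) \<and> (\<exists>x\<in>I \<inter> U. h x \<notin> U)" for I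
  have split: "\<exists>K. good (I \<inter> K) \<and> good (I - K)" if I: "good I" for I
  proof -
    obtain d where d: "depth_le d (\<lambda>x. x \<in> I)" using I unfolding good_def by blast
    obtain x where x: "x \<in> I" "x \<in> U" "h x \<notin> U" using I unfolding good_def by blast
    obtain l' U' K where l': "two_phase h l' U' K" "refines l' (max d d0)"
      using gen unfolding two_phase_at_all_scales_def by blast
    have I_eq: "a \<in> I \<longleftrightarrow> b \<in> I" and U_eq: "a \<in> U \<longleftrightarrow> b \<in> U" if "l' a = l' b" for a b
      using refinesD[OF l'(2) that] depth_leD[OF depth_le_mono[OF d]] depth_leD[OF depth_le_mono[OF d0]]
      by (blast intro: max.cobounded1 max.cobounded2)+
    have cross: "\<exists>y. y \<in> I \<and> y \<in> U \<and> h y \<notin> U \<and> (y \<in> K \<longleftrightarrow> i)" for i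
      using two_phase.crossing[OF l'(1), of x i] x I_eq U_eq by metis
    obtain dK where dK: "depth_le dK (\<lambda>x. x \<in> K)" using two_phase.depth_J[OF l'(1)] by blast
    have depth: "(a \<in> I \<longleftrightarrow> b \<in> I) \<and> (a \<in> K \<longleftrightarrow> b \<in> K)" if "trunc (max d dK) a = trunc (max d dK) b" for a b
      using that depth_leD[OF depth_le_mono[OF d]] depth_leD[OF depth_le_mono[OF dK]]
      by (blast intro: max.cobounded1 max.cobounded2)
    have inv: "h x \<in> I \<longleftrightarrow> x \<in> I" "h x \<in> K \<longleftrightarrow> x \<in> K" for x
      using I two_phase.invariant[OF l'(1)] unfolding good_def by blast+
    have "depth_le (max d dK) (\<lambda>x. x \<in> I \<inter> K)" "depth_le (max d dK) (\<lambda>x. x \<in> I - K)"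
      unfolding depth_le_def using depth by blast+
    then have "good (I \<inter> K)" "good (I - K)"
      unfolding good_def using inv cross[of True] cross[of False] by blast+
    then show ?thesis by blast
  qed
  then obtain \<sigma> where \<sigma>: "\<And>I. good I \<Longrightarrow> good (I \<inter> \<sigma> I) \<and> good (I - \<sigma> I)" by metis
  define tree where
    "tree b = rec_nat UNIV (\<lambda>n I. if b n then I \<inter> \<sigma> I else I - \<sigma> I)" for b :: cantor
  have tree_simps: "tree b 0 = UNIV"
      "tree b (Suc n) = (if b n then tree b n \<inter> \<sigma> (tree b n) else tree b n - \<sigma> (tree b n))" for b n
    by (simp_all add: tree_def)
  have good: "good (tree b n)" for b n
  proof (induction n)
    case 0
    have "depth_le 0 (\<lambda>x::cantor. x \<in> UNIV)" by (simp add: depth_le_def)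
    then show ?case unfolding good_def tree_simps using crossing by blast
  qed (simp add: tree_simps \<sigma>)
  have "\<exists>z\<in>closure leaves - leaves. \<forall>n. z \<in> tree b n" for b
  proof (rule frontier_meets_nested)
    show "continuous_on UNIV h" by (rule carrier_cantor_homeoD(1)[OF h])
    show "surj h" by (rule surjI) (rule carrier_cantor_homeoD(4)[OF h])
    show "decseq (tree b)" by (rule decseq_SucI) (auto simp: tree_simps)
    show "closed (tree b n)" for n
    proof -
      obtain d where d: "depth_le d (\<lambda>x. x \<in> tree b n)" using good unfolding good_def by blast
      then show ?thesis using depth_le_closed[OF d, of "\<lambda>c. c"] by simp
    qed
    show "h x \<in> tree b n \<longleftrightarrow> x \<in> tree b n" "\<exists>x\<in>tree b n \<inter> U. h x \<notin> U" for n x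
      using good unfolding good_def by blast+
  qed
  then obtain z where z: "\<And>b. z b \<in> closure leaves" "\<And>b. z b \<notin> leaves" "\<And>b n. z b \<in> tree b n"
    by (metis DiffE)
  have "inj z"
  proof (rule injI, rule ccontr)
    fix b c assume bc: "z b = z c" "b \<noteq> c"
    then have "\<exists>n. b n \<noteq> c n" by blast
    define n where "n = (LEAST n. b n \<noteq> c n)"
    have n: "b n \<noteq> c n" and less: "\<And>i. i < n \<Longrightarrow> b i = c i"
      unfolding n_def using LeastI_ex[OF \<open>\<exists>n. b n \<noteq> c n\<close>] not_less_Least by blast+
    have "tree b i = tree c i" if "i \<le> n" for i
      using that less by (induction i) (simp_all add: tree_simps)
    then have "tree b n = tree c n" by simp
    then have "tree b (Suc n) \<inter> tree c (Suc n) = {}"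
      using n unfolding tree_simps by auto
    then show False using z(3)[of b "Suc n"] z(3)[of c "Suc n"] bc(1) by auto
  qed
  then have "uncountable (range z)"
    using uncountable_cantor countable_image_inj_on by blast
  then show ?thesis
    using z frontier_not_equicontinuous by (intro exI[of _ "range z"]) blast
qed

section \<open>The comeager conjugacy class\<close>

theorem theorem4p6:
  fixes C :: "(cantor \<Rightarrow> cantor) set" and h :: "cantor \<Rightarrow> cantor"
  assumes "comeager_conjugacy_class C" and "h \<in> C"
  shows "(\<forall>x. \<not> Cantor.recurrent h x \<longrightarrow> Cantor.chain_continuous_at h x) \<and>
    (\<exists>U. open U \<and> closure U = UNIV \<and> (\<forall>x\<in>U. Cantor.chain_continuous_at h x)) \<and>
    (\<exists>S. uncountable S \<and> (\<forall>x\<in>S. \<not> Cantor.equicontinuous_at h x))"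
proof -
  have h: "h \<in> carrier cantor_homeo" "two_phase_at_all_scales h"
    using comeager_conjugacy_class_two_phase[OF assms] by blast+
  have chain: "Cantor.chain_continuous_at h x" if "\<not> Cantor.recurrent h x" for x
    using nonrecurrent_chain_continuous[OF carrier_cantor_homeoD(1)[OF h(1)] h(2) that] .
  obtain U where "open U" "closure U = UNIV" "\<And>x. x \<in> U \<Longrightarrow> \<not> Cantor.recurrent h x"
    using nonrecurrent_dense_open[OF carrier_cantor_homeoD(1)[OF h(1)] h(2)] by blast
  then have "\<exists>U. open U \<and> closure U = UNIV \<and> (\<forall>x\<in>U. Cantor.chain_continuous_at h x)"
    using chain by blast
  then show ?thesis
    using chain uncountable_not_equicontinuous[OF h] by blast
qed

end
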